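(* Every light homomorphism of Artin monoids (associated with Coxeter matrices over finite sets) is a composition of one or more homomorphisms of the following kinds: a tautological homomorphism; a parabolic projection; a natural inclusion; a Tits homomorphism; a diagram automorphism; a folding along a surjective map of index sets of Coxeter matrices. In particular, every light homomorphism of Artin monoids is a composition of standard homomorphisms.
   Context: A Coxeter matrix over a finite set $I$ is a symmetric matrix $M=(m_{ij})_{i,j\in I}$ with $m_{ii}=1$, $m_{ij}\in\mathbb Z_{\ge2}\cup\{\infty\}$ for $i\neq j$. The Artin monoid $\mathrm{Br}^+(M)$ is generated by $T_i$, $i\in I$, subject to $T_iT_jT_i\cdots=T_jT_iT_j\cdots$ ($m_{ij}$ factors on each side) for $i\ne j$, $m_{ij}<\infty$. Convention: $d\cdot\infty=\infty$ for $d\in\mathbb Z_{>0}\cup\{\infty\}$ and $\infty$ is divisible by every positive integer (in particular even). For a homomorphism $\Phi:\mathrm{Br}^+(\widehat M)\to\mathrm{Br}^+(M)$ (identity goes to identity), $[\Phi](i)\subset I$ is the set of indices of generators occurring in $\Phi(\widehat T_i)$. – Light: $|[\Phi](i)|\le1$ for all $i$ (each generator goes to a non-negative power of a generator). – Standard: for every $i\in \widehat I$, the parabolic subgroup $W_{J}(M)=\langle s_j:j\in J\rangle$ of the Coxeter group, $J=[\Phi](i)$, is finite and $\Phi(\widehat T_i)=T_{w_\circ^{J}}$, where $w_\circ^J$ is its longest element and $T_w$ denotes the product of generators along a reduced expression of $w$. – Tautological: $\widehat M=(d_{ij}m_{ij})_{i,j\in I}$ with $d_{ij}=d_{ji}\in\mathbb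 Z_{>0}\cup\{\infty\}$, $d_{ii}=1$, and $\widehat T_i\mapsto T_i$, $i\in I$. – Parabolic projection: for $J\subset I$ with $m_{ij}$ even for all $j\in J$, $i\in I\setminus J$, the homomorphism $P_J:\mathrm{Br}^+(M)\to\mathrm{Br}^+_J(M)=\langle T_j:j\in J\rangle$, $T_i\mapsto T_i$ for $i\in J$, $T_i\mapsto1$ for $i\notin J$. – Natural inclusion: $\mathrm{Br}^+_J(M)\hookrightarrow\mathrm{Br}^+(M)$, $J\subset I$ (where $\mathrm{Br}^+_J(M)\cong\mathrm{Br}^+(M_J)$, $M_J=(m_{ij})_{i,j\in J}$). – Diagram automorphism: $T_i\mapsto T_{\sigma(i)}$ for a permutation $\sigma$ of $I$ with $m_{\sigma(i)\sigma(j)}=m_{ij}$. – Tits homomorphism: for $\mathbf d=(d_i)_{i\in I}\in\mathbb Z_{>0}^I$, the homomorphism $\mathbf T_{\mathbf d}:\mathrm{Br}^+(M(\mathbf d))\to\mathrm{Br}^+(M)$, $\widehat T_i\mapsto T_i^{d_i}$, where $M(\mathbf d)_{ij}=m_{ij}$ if $m_{ij}\le2$ or $d_id_j=1$; $M(\mathbf d)_{ij}=2d_id_j$ if $i\neq j$, $m_{ij}=3$ and $d_id_j\in\{2,3\}$; $M(\mathbf d)_{ij}=\infty$ for all other $i\neq j$; and $M(\mathbf d)_{ii}=1$. – Folding along a surjective map $\varpi:I\to J$: $M$ is foldable along $\varpi$ if $m_{ii'}=m_{ii''}$ whenever $\varpi(i')=\varpi(i'')\ne\varpi(i)$; then $M^\varpi$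 is the Coxeter matrix over $J$ with $(M^\varpi)_{jj'}=m_{ii'}$ for any $i\in\varpi^{-1}(j)$, $i'\in\varpi^{-1}(j')$, $j\neq j'$, and the folding is $\mathbf F_\varpi:\mathrm{Br}^+(M)\to\mathrm{Br}^+(M^\varpi)$, $T_i\mapsto T^\varpi_{\varpi(i)}$. *)

theory Defs
  imports
    "HOL-Algebra.Generated_Groups"
    "HOL-Library.Extended_Nat"
    "HOL-Library.Infinite_Typeclass"
begin

section \<open>Monoids given by generators and relations\<close>

inductive word_cong :: "'a set \<Rightarrow> ('a list \<times> 'a list) set \<Rightarrow> 'a list \<Rightarrow> 'a list \<Rightarrow> bool"
  for S R where
    rel: "(u, v) \<in> R \<Longrightarrow> u \<in> lists S \<Longrightarrow> v \<in> lists S \<Longrightarrow> word_cong S R u v"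
  | refl: "u \<in> lists S \<Longrightarrow> word_cong S R u u"
  | sym: "word_cong S R u v \<Longrightarrow> word_cong S R v u"
  | trans: "word_cong S R u v \<Longrightarrow> word_cong S R v w \<Longrightarrow> word_cong S R u w"
  | append: "word_cong S R u v \<Longrightarrow> word_cong S R u' v' \<Longrightarrow> word_cong S R (u @ u') (v @ v')"

definition word_class :: "'a set \<Rightarrow> ('a list \<times> 'a list) set \<Rightarrow> 'a list \<Rightarrow> 'a list set" where
  "word_class S R u = {v. word_cong S R u v}"

text \<open>The elements of the presented monoid are congruence classes of words, so that
  \<open>w \<in> x\<close> means that the word \<open>w\<close> represents the element \<open>x\<close>.\<close>

definition presented_monoid :: "'a set \<Rightarrow> ('a list \<times> 'a list) set \<Rightarrow> 'a list set monoid" where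
  "presented_monoid S R =
    \<lparr>carrier = word_class S R ` lists S,
     mult = (\<lambda>x y. {w. \<exists>u\<in>x. \<exists>v\<in>y. word_cong S R (u @ v) w}),
     one = word_class S R []\<rparr>"


section \<open>Coxeter matrices, Artin monoids and Coxeter groups\<close>

record 'a coxeter_data =
  index :: "'a set"
  entry :: "'a \<Rightarrow> 'a \<Rightarrow> enat"

text \<open>Only the values of \<open>entry M\<close> on \<open>index M \<times> index M\<close> are meaningful; all definitions
  below depend on these values only (or, for diagram automorphisms, have the same source
  and target).\<close>

definition coxeter_matrix :: "'a coxeter_data \<Rightarrow> bool" where
  "coxeter_matrix M \<longleftrightarrow>
    finite (index M) \<and>
    (\<forall>i\<in>index M. entry M i i = 1) \<and>
    (\<forall>i\<in>index M. \<forall>j\<in>index M. entry M i j = entry M j i) \<and>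
    (\<forall>i\<in>index M. \<forall>j\<in>index M. i \<noteq> j \<longrightarrow> entry M i j \<ge> 2)"

text \<open>The word \<open>i j i \<dots>\<close> with \<open>n\<close> letters.\<close>

definition alt_word :: "nat \<Rightarrow> 'a \<Rightarrow> 'a \<Rightarrow> 'a list" where
  "alt_word n i j = map (\<lambda>k. if even k then i else j) [0..<n]"

definition braid_rels :: "'a coxeter_data \<Rightarrow> ('a list \<times> 'a list) set" where
  "braid_rels M = {(alt_word n i j, alt_word n j i) | i j n.
     i \<in> index M \<and> j \<in> index M \<and> i \<noteq> j \<and> entry M i j = enat n}"

definition artin :: "'a coxeter_data \<Rightarrow> 'a list set monoid" where
  "artin M = presented_monoid (index M) (braid_rels M)"

definition artin_word :: "'a coxeter_data \<Rightarrow> 'a list \<Rightarrow> 'a list set" where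
  "artin_word M u = word_class (index M) (braid_rels M) u"

definition artin_gen :: "'a coxeter_data \<Rightarrow> 'a \<Rightarrow> 'a list set" where
  "artin_gen M i = artin_word M [i]"

text \<open>The Coxeter group has the defining relations \<open>(s\<^sub>i s\<^sub>j)\<^sup>m = 1\<close> for \<open>m = m\<^sub>i\<^sub>j < \<infinity>\<close>.
  The case \<open>i = j\<close> reads \<open>s\<^sub>i s\<^sub>i = 1\<close>; hence the monoid with this presentation is a group,
  and words in the generators suffice to represent all of its elements.\<close>

definition coxeter_rels :: "'a coxeter_data \<Rightarrow> ('a list \<times> 'a list) set" where
  "coxeter_rels M = {(concat (replicate n [i, j]), []) | i j n.
     i \<in> index M \<and> j \<in> index M \<and> entry M i j = enat n}"

definition coxeter_group :: "'a coxeter_data \<Rightarrow> 'a list set monoid" where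
  "coxeter_group M = presented_monoid (index M) (coxeter_rels M)"

definition cox_gen :: "'a coxeter_data \<Rightarrow> 'a \<Rightarrow> 'a list set" where
  "cox_gen M i = word_class (index M) (coxeter_rels M) [i]"

definition parabolic_subgroup :: "'a coxeter_data \<Rightarrow> 'a set \<Rightarrow> 'a list set set" where
  "parabolic_subgroup M J = generate (coxeter_group M) (cox_gen M ` J)"

definition cox_length :: "'a list set \<Rightarrow> nat" where
  "cox_length w = (LEAST n. \<exists>u\<in>w. length u = n)"

definition reduced_expression :: "'a list set \<Rightarrow> 'a list \<Rightarrow> bool" where
  "reduced_expression w u \<longleftrightarrow> u \<in> w \<and> length u = cox_length w"

definition is_longest_element :: "'a coxeter_data \<Rightarrow> 'a set \<Rightarrow> 'a list set \<Rightarrow> bool" where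
  "is_longest_element M J w \<longleftrightarrow>
    w \<in> parabolic_subgroup M J \<and>
    (\<forall>v\<in>parabolic_subgroup M J. v \<noteq> w \<longrightarrow> cox_length v < cox_length w)"

text \<open>\<open>is_T_elem M w x\<close> says that \<open>x\<close> is the element \<open>T\<^sub>w\<close> of the Artin monoid; by Matsumoto's
  theorem it does not depend on the reduced expression, so \<open>x\<close> is determined by \<open>w\<close>.\<close>

definition is_T_elem :: "'a coxeter_data \<Rightarrow> 'a list set \<Rightarrow> 'a list set \<Rightarrow> bool" where
  "is_T_elem M w x \<longleftrightarrow> (\<exists>u. reduced_expression w u \<and> x = artin_word M u)"


section \<open>Homomorphisms of Artin monoids\<close>

text \<open>\<^const>\<open>hom\<close> does not require preservation of the identity. Homomorphisms are taken to be
  extensional, so that equality of functions is equality on the carrier.\<close>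

definition artin_hom ::
    "'a coxeter_data \<Rightarrow> 'a coxeter_data \<Rightarrow> ('a list set \<Rightarrow> 'a list set) \<Rightarrow> bool" where
  "artin_hom M' M \<Phi> \<longleftrightarrow>
    coxeter_matrix M' \<and> coxeter_matrix M \<and>
    \<Phi> \<in> hom (artin M') (artin M) \<and>
    \<Phi> \<one>\<^bsub>artin M'\<^esub> = \<one>\<^bsub>artin M\<^esub> \<and>
    \<Phi> \<in> extensional (carrier (artin M'))"

text \<open>The set \<open>[\<Phi>](i)\<close>. The two sides of a braid relation involve the same letters, so all
  words representing an element have the same set of letters.\<close>

definition gen_support ::
    "'a coxeter_data \<Rightarrow> ('a list set \<Rightarrow> 'a list set) \<Rightarrow> 'a \<Rightarrow> 'a set" where
  "gen_support M' \<Phi> i = (\<Union>u\<in>\<Phi> (artin_gen M' i). set u)"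

definition light_hom ::
    "'a coxeter_data \<Rightarrow> 'a coxeter_data \<Rightarrow> ('a list set \<Rightarrow> 'a list set) \<Rightarrow> bool" where
  "light_hom M' M \<Phi> \<longleftrightarrow>
    artin_hom M' M \<Phi> \<and> (\<forall>i\<in>index M'. card (gen_support M' \<Phi> i) \<le> 1)"

definition standard_hom ::
    "'a coxeter_data \<Rightarrow> 'a coxeter_data \<Rightarrow> ('a list set \<Rightarrow> 'a list set) \<Rightarrow> bool" where
  "standard_hom M' M \<Phi> \<longleftrightarrow>
    artin_hom M' M \<Phi> \<and>
    (\<forall>i\<in>index M'.
       finite (parabolic_subgroup M (gen_support M' \<Phi> i)) \<and>
       (\<exists>w. is_longest_element M (gen_support M' \<Phi> i) w \<and> is_T_elem M w (\<Phi> (artin_gen M' i))))"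

definition tautological_hom ::
    "'a coxeter_data \<Rightarrow> 'a coxeter_data \<Rightarrow> ('a list set \<Rightarrow> 'a list set) \<Rightarrow> bool" where
  "tautological_hom M' M \<Phi> \<longleftrightarrow>
    artin_hom M' M \<Phi> \<and>
    index M' = index M \<and>
    (\<exists>d :: 'a \<Rightarrow> 'a \<Rightarrow> enat.
       (\<forall>i\<in>index M. \<forall>j\<in>index M.
          d i j = d j i \<and> d i j > 0 \<and> entry M' i j = d i j * entry M i j) \<and>
       (\<forall>i\<in>index M. d i i = 1)) \<and>
    (\<forall>i\<in>index M. \<Phi> (artin_gen M' i) = artin_gen M i)"

text \<open>\<open>is_submatrix N M J\<close> says that \<open>N\<close> is \<open>M\<^sub>J\<close>. The parabolic submonoid generated by the
  \<open>T\<^sub>j\<close> with \<open>j \<in> J\<close> is represented by the isomorphic Artin monoid of \<open>M\<^sub>J\<close>.\<close>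

definition is_submatrix :: "'a coxeter_data \<Rightarrow> 'a coxeter_data \<Rightarrow> 'a set \<Rightarrow> bool" where
  "is_submatrix N M J \<longleftrightarrow>
    J \<subseteq> index M \<and> index N = J \<and> (\<forall>i\<in>J. \<forall>j\<in>J. entry N i j = entry M i j)"

definition parabolic_projection ::
    "'a coxeter_data \<Rightarrow> 'a coxeter_data \<Rightarrow> ('a list set \<Rightarrow> 'a list set) \<Rightarrow> bool" where
  "parabolic_projection M N \<Phi> \<longleftrightarrow>
    artin_hom M N \<Phi> \<and>
    (\<exists>J. is_submatrix N M J \<and>
       (\<forall>j\<in>J. \<forall>i\<in>index M - J. 2 dvd entry M i j) \<and>
       (\<forall>i\<in>J. \<Phi> (artin_gen M i) = artin_gen N i) \<and>
       (\<forall>i\<in>index M - J. \<Phi> (artin_gen M i) = \<one>\<^bsub>artin N\<^esub>))"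

definition natural_inclusion ::
    "'a coxeter_data \<Rightarrow> 'a coxeter_data \<Rightarrow> ('a list set \<Rightarrow> 'a list set) \<Rightarrow> bool" where
  "natural_inclusion N M \<Phi> \<longleftrightarrow>
    artin_hom N M \<Phi> \<and> (\<exists>J. is_submatrix N M J \<and> (\<forall>j\<in>J. \<Phi> (artin_gen N j) = artin_gen M j))"

definition diagram_automorphism ::
    "'a coxeter_data \<Rightarrow> 'a coxeter_data \<Rightarrow> ('a list set \<Rightarrow> 'a list set) \<Rightarrow> bool" where
  "diagram_automorphism M' M \<Phi> \<longleftrightarrow>
    artin_hom M' M \<Phi> \<and> M' = M \<and>
    (\<exists>\<sigma>. bij_betw \<sigma> (index M) (index M) \<and>
       (\<forall>i\<in>index M. \<forall>j\<in>index M. entry M (\<sigma> i) (\<sigma> j) = entry M i j) \<and>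
       (\<forall>i\<in>index M. \<Phi> (artin_gen M i) = artin_gen M (\<sigma> i)))"

definition tits_entry :: "'a coxeter_data \<Rightarrow> ('a \<Rightarrow> nat) \<Rightarrow> 'a \<Rightarrow> 'a \<Rightarrow> enat" where
  "tits_entry M d i j =
    (if i = j then 1
     else if entry M i j \<le> 2 \<or> d i * d j = 1 then entry M i j
     else if entry M i j = 3 \<and> d i * d j \<in> {2, 3} then enat (2 * d i * d j)
     else \<infinity>)"

definition tits_hom ::
    "'a coxeter_data \<Rightarrow> 'a coxeter_data \<Rightarrow> ('a list set \<Rightarrow> 'a list set) \<Rightarrow> bool" where
  "tits_hom M' M \<Phi> \<longleftrightarrow>
    artin_hom M' M \<Phi> \<and>
    index M' = index M \<and>
    (\<exists>d :: 'a \<Rightarrow> nat.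
       (\<forall>i\<in>index M. d i > 0) \<and>
       (\<forall>i\<in>index M. \<forall>j\<in>index M. entry M' i j = tits_entry M d i j) \<and>
       (\<forall>i\<in>index M. \<Phi> (artin_gen M' i) = artin_gen M i [^]\<^bsub>artin M\<^esub> d i))"

definition foldable :: "'a coxeter_data \<Rightarrow> ('a \<Rightarrow> 'a) \<Rightarrow> bool" where
  "foldable M \<pi> \<longleftrightarrow>
    (\<forall>i\<in>index M. \<forall>i'\<in>index M. \<forall>i''\<in>index M.
       \<pi> i' = \<pi> i'' \<and> \<pi> i'' \<noteq> \<pi> i \<longrightarrow> entry M i i' = entry M i i'')"

definition folding ::
    "'a coxeter_data \<Rightarrow> 'a coxeter_data \<Rightarrow> ('a list set \<Rightarrow> 'a list set) \<Rightarrow> bool" where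
  "folding M N \<Phi> \<longleftrightarrow>
    artin_hom M N \<Phi> \<and>
    (\<exists>\<pi>. \<pi> ` index M = index N \<and> foldable M \<pi> \<and>
       (\<forall>i\<in>index M. \<forall>i'\<in>index M. \<pi> i \<noteq> \<pi> i' \<longrightarrow> entry N (\<pi> i) (\<pi> i') = entry M i i') \<and>
       (\<forall>i\<in>index M. \<Phi> (artin_gen M i) = artin_gen N (\<pi> i)))"

definition elementary_light_hom ::
    "'a coxeter_data \<Rightarrow> 'a coxeter_data \<Rightarrow> ('a list set \<Rightarrow> 'a list set) \<Rightarrow> bool" where
  "elementary_light_hom M' M \<Phi> \<longleftrightarrow>
    tautological_hom M' M \<Phi> \<or> parabolic_projection M' M \<Phi> \<or> natural_inclusion M' M \<Phi> \<or>
    tits_hom M' M \<Phi> \<or> diagram_automorphism M' M \<Phi> \<or> folding M' M \<Phi>"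

text \<open>Compositions of one or more homomorphisms of a class \<open>K\<close>. All index sets are subsets of
  one type \<open>'a\<close>; those of the intermediate matrices need not be related to the index sets of
  the two ends, so the main result takes \<open>'a\<close> to be infinite. This is no
  restriction, as any two finite sets embed into an infinite type.\<close>

inductive composite_of ::
    "('a coxeter_data \<Rightarrow> 'a coxeter_data \<Rightarrow> ('a list set \<Rightarrow> 'a list set) \<Rightarrow> bool) \<Rightarrow>
     'a coxeter_data \<Rightarrow> 'a coxeter_data \<Rightarrow> ('a list set \<Rightarrow> 'a list set) \<Rightarrow> bool"
  for K where
    single: "K M' M \<Phi> \<Longrightarrow> composite_of K M' M \<Phi>"
  | comp: "composite_of K M\<^sub>1 M\<^sub>2 \<Phi> \<Longrightarrow> K M\<^sub>2 M\<^sub>3 \<Psi> \<Longrightarrow>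
      composite_of K M\<^sub>1 M\<^sub>3 (compose (carrier (artin M\<^sub>1)) \<Psi> \<Phi>)"

end

theory Submission
  imports Defs Complex_Main "HOL-Library.Sublist"
begin

text \<open>A light homomorphism sends \<open>T\<^sub>i\<close> to \<open>T\<^bsub>f(i)\<^esub>\<close> raised to a power \<open>d\<^sub>i\<close>. Comparing lengths, a
  finite \<open>m\<^sub>i\<^sub>j\<close> with \<open>d\<^sub>i \<noteq> d\<^sub>j\<close> is even; if \<open>f(i) \<noteq> f(j)\<close> and both exponents are positive, it is
  a multiple of the Tits entry. The latter follows from the action of the dihedral group on
  \<open>\<int>/m\<close> (exponents \<open>1\<close>), from the action of the three strand braid monoid on \<open>\<int>\<^sup>2\<close> (one exponent
  \<open>1\<close> and \<open>m = 3\<close>), and in the remaining cases because no braid relation applies to the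
  words in question. Hence the homomorphism factors as follows: project to the \<open>i\<close> with
  \<open>d\<^sub>i > 0\<close>, replace the matrix tautologically by one whose entries depend only on \<open>(f, d)\<close>
  unless these agree, fold along \<open>(f, d)\<close>, apply a Tits homomorphism, fold along \<open>f\<close>, include.

  The Tits homomorphism is in turn a folding after the standard homomorphism
  that replaces \<open>T\<^sub>i\<close> by a product of \<open>d\<^sub>i\<close> commuting generators. Such a product is
  \<open>T\<^sub>w\<close> for the longest element \<open>w\<close>: a word for \<open>w\<close> has to contain each of these generators
  \<open>s\<close>, since the geometric representation has a vector that \<open>w\<close> moves but all other
  generators fix.\<close>

section \<open>Presented monoids\<close>

lemma word_cong_lists:
  "word_cong S R u v \<Longrightarrow> u \<in> lists S \<and> v \<in> lists S"
  by (induction rule: word_cong.induct) auto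

lemma word_cong_trans [trans]:
  "word_cong S R u v \<Longrightarrow> word_cong S R v w \<Longrightarrow> word_cong S R u w"
  by (fact word_cong.trans)

lemma word_cong_context:
  assumes "word_cong S R u v" "p \<in> lists S" "q \<in> lists S"
  shows "word_cong S R (p @ u @ q) (p @ v @ q)"
  by (rule word_cong.append[OF word_cong.refl[OF assms(2)]
        word_cong.append[OF assms(1) word_cong.refl[OF assms(3)]]])

lemma word_class_eq_iff:
  assumes "u \<in> lists S"
  shows "word_class S R u = word_class S R v \<longleftrightarrow> word_cong S R u v"
proof
  assume "word_class S R u = word_class S R v"
  then have "word_cong S R v u"
    using word_cong.refl[OF assms, of R] by (auto simp: word_class_def)
  then show "word_cong S R u v" by (rule word_cong.sym)
next
  assume "word_cong S R u v"
  then show "word_class S R u = word_class S R v"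
    by (auto simp: word_class_def intro: word_cong.trans word_cong.trans[OF word_cong.sym])
qed

lemma in_word_class_self: "u \<in> lists S \<Longrightarrow> u \<in> word_class S R u"
  by (simp add: word_class_def word_cong.refl)

lemma carrier_presented_monoid:
  "carrier (presented_monoid S R) = word_class S R ` lists S"
  by (simp add: presented_monoid_def)

lemma mult_presented_monoid:
  assumes "u \<in> lists S" "v \<in> lists S"
  shows "word_class S R u \<otimes>\<^bsub>presented_monoid S R\<^esub> word_class S R v = word_class S R (u @ v)"
proof -
  have "word_cong S R (u @ v) w"
    if "word_cong S R u u'" "word_cong S R v v'" "word_cong S R (u' @ v') w" for u' v' w
    using word_cong.trans[OF word_cong.append[OF that(1,2)] that(3)] .
  moreover have "word_cong S R u u" "word_cong S R v v"
    using assms by (auto intro: word_cong.refl)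
  ultimately have "(\<exists>u'. word_cong S R u u' \<and> (\<exists>v'. word_cong S R v v' \<and> word_cong S R (u' @ v') w)) \<longleftrightarrow>
      word_cong S R (u @ v) w" for w
    by meson
  then show ?thesis
    by (simp add: presented_monoid_def word_class_def Bex_def)
qed

lemma one_presented_monoid: "\<one>\<^bsub>presented_monoid S R\<^esub> = word_class S R []"
  by (simp add: presented_monoid_def)

lemma monoid_presented_monoid: "monoid (presented_monoid S R)"
proof (rule monoidI)
  fix x y assume "x \<in> carrier (presented_monoid S R)" "y \<in> carrier (presented_monoid S R)"
  then obtain u v where "u \<in> lists S" "v \<in> lists S" "x = word_class S R u" "y = word_class S R v"
    by (auto simp: carrier_presented_monoid)
  then show "x \<otimes>\<^bsub>presented_monoid S R\<^esub> y \<in> carrier (presented_monoid S R)"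
    by (simp add: mult_presented_monoid carrier_presented_monoid)
next
  show "\<one>\<^bsub>presented_monoid S R\<^esub> \<in> carrier (presented_monoid S R)"
    by (simp add: one_presented_monoid carrier_presented_monoid)
qed (auto simp: carrier_presented_monoid one_presented_monoid mult_presented_monoid
  simp flip: in_lists_conv_set)

lemma word_cong_fold:
  assumes "word_cong S R u v"
    and "\<And>l r. (l, r) \<in> R \<Longrightarrow> fold act l = fold act r"
  shows "fold act u = fold act v"
  using assms(1) by (induction rule: word_cong.induct) (auto simp: assms(2))

text \<open>Relations that preserve the set of letters never lead out of the alphabet of
  \<open>u\<close>. Only those over \<open>A\<close> have to be respected, so an action tailored to
  two generators suffices.\<close>

lemma word_cong_fold_on:
  assumes "word_cong S R u v"
    and "\<And>l r. (l, r) \<in> R \<Longrightarrow> set l = set r"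
    and "\<And>l r. (l, r) \<in> R \<Longrightarrow> set l \<subseteq> A \<Longrightarrow> fold act l = fold act r"
  shows "set u = set v \<and> (set u \<subseteq> A \<longrightarrow> fold act u = fold act v)"
  using assms(1) by (induction rule: word_cong.induct) (auto simp: assms(2,3))

text \<open>A derivation has to begin by replacing a side of a relation somewhere in the word;
  without such a factor it cannot leave \<open>u\<close>.\<close>

lemma word_cong_no_relation:
  assumes "word_cong S R u v"
    and "\<And>l r. (l, r) \<in> R \<Longrightarrow> \<not> sublist l u \<and> \<not> sublist r u"
  shows "u = v"
proof -
  define free where "free w \<longleftrightarrow> (\<forall>l r. (l, r) \<in> R \<longrightarrow> \<not> sublist l w \<and> \<not> sublist r w)" for w
  have free_append: "free w \<and> free w'" if "free (w @ w')" for w w'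
    using that by (auto simp: free_def sublist_append)
  \<comment> \<open>The disjunction makes the claim symmetric, as the symmetry rule requires;
    factors of a free word are free, which handles concatenation.\<close>
  have "(free u \<or> free v) \<longrightarrow> u = v"
    using assms(1)
  proof (induction rule: word_cong.induct)
    case (rel u v)
    then have "\<not> free u" "\<not> free v" unfolding free_def by (meson sublist_order.order_refl)+
    then show ?case by simp
  next
    case (append u v u' v')
    then show ?case using free_append[of u u'] free_append[of v v'] by metis
  next
    case (trans u v w)
    then show ?case by metis
  qed blast+
  moreover have "free u" unfolding free_def by (intro allI impI assms(2))
  ultimately show ?thesis by simp
qed

section \<open>Alternating products\<close>

text \<open>The image of an alternating word when words are substituted for its two letters;
  \<open>n\<close> counts factors, not letters.\<close>

fun alt_prod :: "nat \<Rightarrow> 'a list \<Rightarrow> 'a list \<Rightarrow> 'a list" where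
  "alt_prod 0 u v = []"
| "alt_prod (Suc n) u v = u @ alt_prod n v u"

lemma alt_word_0 [simp]: "alt_word 0 i j = []"
  by (simp add: alt_word_def)

lemma alt_word_Suc: "alt_word (Suc n) i j = i # alt_word n j i"
proof -
  have "[0..<Suc n] = 0 # map Suc [0..<n]"
    by (simp only: map_Suc_upt upt_conv_Cons zero_less_Suc)
  then show ?thesis by (simp add: alt_word_def comp_def del: upt_Suc)
qed

lemma length_alt_word [simp]: "length (alt_word n i j) = n"
  by (simp add: alt_word_def)

lemma set_alt_word_subset: "set (alt_word n i j) \<subseteq> {i, j}"
  by (auto simp: alt_word_def)

lemma set_alt_word: "n \<ge> 2 \<Longrightarrow> set (alt_word n i j) = {i, j}"
proof -
  assume "n \<ge> 2"
  then obtain k where "n = Suc (Suc k)" by (metis add_2_eq_Suc le_iff_add)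
  then show ?thesis using set_alt_word_subset[of k i j] by (auto simp: alt_word_Suc)
qed

lemma concat_map_alt_word: "concat (map h (alt_word n i j)) = alt_prod n (h i) (h j)"
  by (induction n arbitrary: i j) (auto simp: alt_word_Suc)

lemma alt_prod_singleton: "alt_prod n [i] [j] = alt_word n i j"
  by (induction n arbitrary: i j) (auto simp: alt_word_Suc)

lemma alt_prod_lists: "u \<in> lists S \<Longrightarrow> v \<in> lists S \<Longrightarrow> alt_prod n u v \<in> lists S"
  by (induction n arbitrary: u v) auto

lemma set_alt_prod_subset: "set (alt_prod n u v) \<subseteq> set u \<union> set v"
  by (induction n arbitrary: u v) auto

lemma alt_prod_add:
  "alt_prod (m + n) u v = alt_prod m u v @ (if even m then alt_prod n u v else alt_prod n v u)"
  by (induction m arbitrary: u v) auto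

lemma alt_prod_double: "alt_prod (2 * k) u v = concat (replicate k (u @ v))"
  by (induction k) auto

lemma alt_prod_Nil:
  "even n \<Longrightarrow> alt_prod n u [] = concat (replicate (n div 2) u)"
  "even n \<Longrightarrow> alt_prod n [] u = concat (replicate (n div 2) u)"
  by (auto simp: alt_prod_double elim!: evenE)

lemma length_alt_prod:
  "length (alt_prod n u v) = (n + 1) div 2 * length u + n div 2 * length v"
proof (induction n arbitrary: u v)
  case (Suc n)
  have "(Suc n + 1) div 2 = Suc (n div 2)" by simp
  then show ?case using Suc[of v u] by simp
qed simp

lemma count_list_alt_prod:
  "count_list (alt_prod n u v) x = (n + 1) div 2 * count_list u x + n div 2 * count_list v x"
proof (induction n arbitrary: u v)
  case (Suc n)
  have "(Suc n + 1) div 2 = Suc (n div 2)" by simp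
  then show ?case using Suc[of v u] by simp
qed simp

text \<open>Cut the product into blocks of \<open>n\<close> factors and apply the relation to each.
  After an odd block the roles of \<open>u\<close> and \<open>v\<close> are exchanged, so the
  induction carries both orientations.\<close>

lemma word_cong_alt_prod_dvd:
  assumes "word_cong S R (alt_prod n u v) (alt_prod n v u)" "n dvd N"
    and "u \<in> lists S" "v \<in> lists S"
  shows "word_cong S R (alt_prod N u v) (alt_prod N v u)"
proof -
  have "word_cong S R (alt_prod (n * k) u v) (alt_prod (n * k) v u) \<and>
      word_cong S R (alt_prod (n * k) v u) (alt_prod (n * k) u v)" for k
  proof (induction k)
    case 0
    then show ?case by (simp add: word_cong.refl)
  next
    case (Suc k)
    then show ?case
      using assms(1) word_cong.sym[OF assms(1)]
      by (auto simp: alt_prod_add intro!: word_cong.append)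
  qed
  then show ?thesis using assms(2) by (auto simp: dvd_def)
qed

section \<open>Homomorphisms given by words\<close>

abbreviation braid_cong :: "'a coxeter_data \<Rightarrow> 'a list \<Rightarrow> 'a list \<Rightarrow> bool" where
  "braid_cong M \<equiv> word_cong (index M) (braid_rels M)"

lemma coxeter_matrixD:
  assumes "coxeter_matrix M"
  shows "finite (index M)"
    and "i \<in> index M \<Longrightarrow> entry M i i = 1"
    and "i \<in> index M \<Longrightarrow> j \<in> index M \<Longrightarrow> entry M i j = entry M j i"
    and "i \<in> index M \<Longrightarrow> j \<in> index M \<Longrightarrow> i \<noteq> j \<Longrightarrow> 2 \<le> entry M i j"
  using assms unfolding coxeter_matrix_def by blast+

lemma coxeter_matrix_finite_entry:
  assumes "coxeter_matrix M" "i \<in> index M" "j \<in> index M" "i \<noteq> j" "entry M i j = enat n"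
  shows "2 \<le> n"
  using coxeter_matrixD(4)[OF assms(1-4)] assms(5)
  by (metis enat_ord_simps(1) numeral_eq_enat)

lemma braid_cong_alt_word:
  assumes "i \<in> index M" "j \<in> index M" "i \<noteq> j" "entry M i j = enat n"
  shows "braid_cong M (alt_word n i j) (alt_word n j i)"
proof (rule word_cong.rel)
  show "(alt_word n i j, alt_word n j i) \<in> braid_rels M"
    using assms unfolding braid_rels_def by blast
qed (use assms set_alt_word_subset[of n i j] set_alt_word_subset[of n j i] in \<open>auto simp: in_lists_conv_set\<close>)

lemma braid_relsE:
  assumes "(l, r) \<in> braid_rels M"
  obtains i j n where "i \<in> index M" "j \<in> index M" "i \<noteq> j" "entry M i j = enat n"
    "l = alt_word n i j" "r = alt_word n j i"
  using assms by (auto simp: braid_rels_def)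

lemma set_eq_of_braid_rels:
  assumes "coxeter_matrix M" "(l, r) \<in> braid_rels M"
  shows "set l = set r"
proof -
  obtain i j n where "l = alt_word n i j" "r = alt_word n j i" "2 \<le> n"
    using assms(2) coxeter_matrix_finite_entry[OF assms(1)] by (metis braid_relsE)
  then show ?thesis by (simp add: set_alt_word insert_commute)
qed

lemma braid_cong_set:
  assumes "coxeter_matrix M" "braid_cong M u v"
  shows "set u = set v"
  using assms(2)
proof (induction rule: word_cong.induct)
  case (rel u v)
  then show ?case using set_eq_of_braid_rels[OF assms(1)] by blast
qed auto

lemma braid_cong_length: "braid_cong M u v \<Longrightarrow> length u = length v"
  by (induction rule: word_cong.induct) (auto simp: braid_rels_def)

lemma carrier_artin: "carrier (artin M) = artin_word M ` lists (index M)"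
  by (simp add: artin_def artin_word_def carrier_presented_monoid image_def)

lemma one_artin: "\<one>\<^bsub>artin M\<^esub> = artin_word M []"
  by (simp add: artin_def artin_word_def one_presented_monoid)

lemma mult_artin:
  "u \<in> lists (index M) \<Longrightarrow> v \<in> lists (index M) \<Longrightarrow>
    artin_word M u \<otimes>\<^bsub>artin M\<^esub> artin_word M v = artin_word M (u @ v)"
  by (simp add: artin_def artin_word_def mult_presented_monoid)

lemma artin_word_eq_iff:
  "u \<in> lists (index M) \<Longrightarrow> artin_word M u = artin_word M v \<longleftrightarrow> braid_cong M u v"
  by (simp add: artin_word_def word_class_eq_iff)

lemma artin_gen_power:
  assumes "i \<in> index M"
  shows "artin_gen M i [^]\<^bsub>artin M\<^esub> n = artin_word M (replicate n i)"
proof (induction n)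
  case 0
  then show ?case by (simp add: nat_pow_def one_artin)
next
  case (Suc n)
  then show ?case
    using assms by (simp add: nat_pow_def artin_gen_def mult_artin in_lists_conv_set
      replicate_append_same)
qed

definition word_map :: "'a coxeter_data \<Rightarrow> 'a coxeter_data \<Rightarrow> ('a \<Rightarrow> 'a list) \<Rightarrow> bool" where
  "word_map M' M h \<longleftrightarrow>
    (\<forall>i\<in>index M'. h i \<in> lists (index M)) \<and>
    (\<forall>i\<in>index M'. \<forall>j\<in>index M'. \<forall>n. i \<noteq> j \<longrightarrow> entry M' i j = enat n \<longrightarrow>
       braid_cong M (alt_prod n (h i) (h j)) (alt_prod n (h j) (h i)))"

text \<open>Elements are classes, hence the choice of a representative, harmless once
  \<open>h\<close> respects the braid relations; restriction to the carrier makes the map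
  extensional, as \<open>artin_hom\<close> demands.\<close>

definition artin_map ::
    "'a coxeter_data \<Rightarrow> 'a coxeter_data \<Rightarrow> ('a \<Rightarrow> 'a list) \<Rightarrow> 'a list set \<Rightarrow> 'a list set" where
  "artin_map M' M h =
    (\<lambda>x\<in>carrier (artin M'). artin_word M (concat (map h (SOME u. u \<in> x))))"

lemma word_mapD:
  assumes "word_map M' M h"
  shows "i \<in> index M' \<Longrightarrow> h i \<in> lists (index M)"
    and "i \<in> index M' \<Longrightarrow> j \<in> index M' \<Longrightarrow> i \<noteq> j \<Longrightarrow> entry M' i j = enat n \<Longrightarrow>
      braid_cong M (alt_prod n (h i) (h j)) (alt_prod n (h j) (h i))"
  using assms by (auto simp: word_map_def)

lemma word_map_lists:
  assumes "word_map M' M h" "u \<in> lists (index M')"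
  shows "concat (map h u) \<in> lists (index M)"
  using assms(2) word_mapD(1)[OF assms(1)] by (fastforce simp: in_lists_conv_set)

lemma word_map_cong:
  assumes "word_map M' M h" "braid_cong M' u v"
  shows "braid_cong M (concat (map h u)) (concat (map h v))"
  using assms(2)
proof (induction rule: word_cong.induct)
  case (rel u v)
  then show ?case
    using word_mapD(2)[OF assms(1)] by (auto simp: braid_rels_def concat_map_alt_word)
next
  case (refl u)
  then show ?case by (intro word_cong.refl word_map_lists[OF assms(1)])
next
  case (sym u v)
  show ?case by (rule word_cong.sym[OF sym.IH])
next
  case (trans u v w)
  show ?case by (rule word_cong.trans[OF trans.IH])
next
  case (append u v u' v')
  then show ?case by (simp add: word_cong.append)
qed

lemma artin_map_artin_word:
  assumes "word_map M' M h" "u \<in> lists (index M')"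
  shows "artin_map M' M h (artin_word M' u) = artin_word M (concat (map h u))"
proof -
  have "u \<in> artin_word M' u"
    using assms(2) by (simp add: artin_word_def in_word_class_self)
  then have "(SOME v. v \<in> artin_word M' u) \<in> artin_word M' u"
    by (rule someI)
  then have "braid_cong M' u (SOME v. v \<in> artin_word M' u)"
    by (simp add: artin_word_def word_class_def)
  then have "braid_cong M (concat (map h u)) (concat (map h (SOME v. v \<in> artin_word M' u)))"
    by (rule word_map_cong[OF assms(1)])
  then have "artin_word M (concat (map h u)) =
      artin_word M (concat (map h (SOME v. v \<in> artin_word M' u)))"
    using artin_word_eq_iff[OF word_map_lists[OF assms]] by blast
  moreover have "artin_word M' u \<in> carrier (artin M')"
    using assms(2) by (simp add: carrier_artin)
  ultimately show ?thesis by (simp add: artin_map_def)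
qed

lemma artin_map_gen:
  assumes "word_map M' M h" "i \<in> index M'"
  shows "artin_map M' M h (artin_gen M' i) = artin_word M (h i)"
  using artin_map_artin_word[OF assms(1), of "[i]"] assms(2) by (simp add: artin_gen_def)

lemma artin_hom_artin_map:
  assumes "coxeter_matrix M'" "coxeter_matrix M" "word_map M' M h"
  shows "artin_hom M' M (artin_map M' M h)"
  unfolding artin_hom_def
proof (intro conjI)
  show "artin_map M' M h \<in> hom (artin M') (artin M)"
  proof (rule homI)
    fix x assume "x \<in> carrier (artin M')"
    then obtain u where u: "u \<in> lists (index M')" "x = artin_word M' u"
      unfolding carrier_artin by (rule imageE)
    show "artin_map M' M h x \<in> carrier (artin M)"
      unfolding u(2) artin_map_artin_word[OF assms(3) u(1)] carrier_artin
      by (intro imageI word_map_lists[OF assms(3) u(1)])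
  next
    fix x y assume "x \<in> carrier (artin M')" "y \<in> carrier (artin M')"
    then obtain u v where "u \<in> lists (index M')" "v \<in> lists (index M')"
      "x = artin_word M' u" "y = artin_word M' v"
      by (auto simp: carrier_artin)
    then show "artin_map M' M h (x \<otimes>\<^bsub>artin M'\<^esub> y) =
        artin_map M' M h x \<otimes>\<^bsub>artin M\<^esub> artin_map M' M h y"
      using artin_map_artin_word[OF assms(3), of "u @ v"] word_map_lists[OF assms(3)]
      by (simp add: mult_artin artin_map_artin_word[OF assms(3)])
  qed
  show "artin_map M' M h \<one>\<^bsub>artin M'\<^esub> = \<one>\<^bsub>artin M\<^esub>"
    using artin_map_artin_word[OF assms(3), of "[]"] by (simp add: one_artin)
  show "artin_map M' M h \<in> extensional (carrier (artin M'))"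
    by (simp add: artin_map_def)
qed (use assms in auto)

lemma artin_hom_artin_word:
  assumes "artin_hom M' M \<Phi>"
    and "\<And>i. i \<in> index M' \<Longrightarrow> h i \<in> lists (index M) \<and> \<Phi> (artin_gen M' i) = artin_word M (h i)"
    and "u \<in> lists (index M')"
  shows "\<Phi> (artin_word M' u) = artin_word M (concat (map h u))"
  using assms(3)
proof (induction u)
  case Nil
  then show ?case using assms(1) by (simp add: artin_hom_def one_artin)
next
  case (Cons i u)
  then have u: "u \<in> lists (index M')" "i \<in> index M'" by auto
  have "artin_word M' (i # u) = artin_gen M' i \<otimes>\<^bsub>artin M'\<^esub> artin_word M' u"
    using u mult_artin[of "[i]" M' u] by (simp add: artin_gen_def)
  also have "\<Phi> \<dots> = \<Phi> (artin_gen M' i) \<otimes>\<^bsub>artin M\<^esub> \<Phi> (artin_word M' u)"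
    using assms(1) u by (intro hom_mult) (auto simp: artin_hom_def carrier_artin artin_gen_def)
  also have "\<dots> = artin_word M (concat (map h (i # u)))"
  proof -
    have "concat (map h u) \<in> lists (index M)"
      using u(1) assms(2) by (fastforce simp: in_lists_conv_set)
    then show ?thesis using Cons.IH u assms(2)[of i] by (simp add: mult_artin)
  qed
  finally show ?case .
qed

text \<open>A homomorphism is determined by its values on generators, and words chosen for these
  values must satisfy the images of the braid relations. This is the passage from abstract
  homomorphisms to words.\<close>

lemma artin_hom_eq_artin_map:
  assumes "artin_hom M' M \<Phi>"
    and "\<And>i. i \<in> index M' \<Longrightarrow> h i \<in> lists (index M) \<and> \<Phi> (artin_gen M' i) = artin_word M (h i)"
  shows "word_map M' M h" and "\<Phi> = artin_map M' M h"
proof -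
  have \<Phi>: "\<Phi> (artin_word M' u) = artin_word M (concat (map h u))" if "u \<in> lists (index M')" for u
    by (rule artin_hom_artin_word[OF assms(1) _ that]) (rule assms(2))
  show h: "word_map M' M h"
    unfolding word_map_def
  proof (intro conjI ballI allI impI)
    fix i j n assume ij: "i \<in> index M'" "j \<in> index M'" "i \<noteq> j" "entry M' i j = enat n"
    note rel = braid_cong_alt_word[OF this]
    have lists: "alt_word n i j \<in> lists (index M')" "alt_word n j i \<in> lists (index M')"
      using word_cong_lists[OF rel] by auto
    have "artin_word M' (alt_word n i j) = artin_word M' (alt_word n j i)"
      using artin_word_eq_iff[OF lists(1)] rel by blast
    then have "artin_word M (alt_prod n (h i) (h j)) = artin_word M (alt_prod n (h j) (h i))"
      using \<Phi>[OF lists(1)] \<Phi>[OF lists(2)] by (simp add: concat_map_alt_word)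
    then show "braid_cong M (alt_prod n (h i) (h j)) (alt_prod n (h j) (h i))"
      using assms(2) ij by (simp add: artin_word_eq_iff alt_prod_lists)
  qed (use assms in blast)
  show "\<Phi> = artin_map M' M h"
  proof
    fix x
    show "\<Phi> x = artin_map M' M h x"
    proof (cases "x \<in> carrier (artin M')")
      case True
      then show ?thesis using \<Phi> artin_map_artin_word[OF h] by (auto simp: carrier_artin)
    next
      case False
      then show ?thesis using assms(1) by (simp add: artin_hom_def artin_map_def extensional_def)
    qed
  qed
qed

lemma artin_map_cong:
  assumes "\<And>i. i \<in> index M' \<Longrightarrow> h i = h' i" "word_map M' M h"
    and "coxeter_matrix M'" "coxeter_matrix M"
  shows "artin_map M' M h = artin_map M' M h'"
proof -
  have "word_map M' M h'" using assms(1,2) by (simp add: word_map_def)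
  moreover have "artin_hom M' M (artin_map M' M h)" by (rule artin_hom_artin_map[OF assms(3,4,2)])
  ultimately show ?thesis
    using assms(1) artin_map_gen[OF assms(2)] word_mapD(1)[OF assms(2)]
    by (intro artin_hom_eq_artin_map(2)) simp_all
qed

lemma word_map_comp:
  assumes "word_map M\<^sub>1 M\<^sub>2 g" "word_map M\<^sub>2 M\<^sub>3 h"
  shows "word_map M\<^sub>1 M\<^sub>3 (\<lambda>i. concat (map h (g i)))"
  unfolding word_map_def
proof (intro conjI ballI allI impI)
  have *: "alt_prod n (concat (map h u)) (concat (map h v)) = concat (map h (alt_prod n u v))"
    for n u v
    by (induction n arbitrary: u v) auto
  fix i j n assume "i \<in> index M\<^sub>1" "j \<in> index M\<^sub>1" "i \<noteq> j" "entry M\<^sub>1 i j = enat n"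
  then show "braid_cong M\<^sub>3 (alt_prod n (concat (map h (g i))) (concat (map h (g j))))
      (alt_prod n (concat (map h (g j))) (concat (map h (g i))))"
    unfolding * by (intro word_map_cong[OF assms(2)] word_mapD(2)[OF assms(1)])
qed (use word_map_lists[OF assms(2)] word_mapD(1)[OF assms(1)] in blast)

lemma compose_artin_map:
  assumes "word_map M\<^sub>1 M\<^sub>2 g" "word_map M\<^sub>2 M\<^sub>3 h"
  shows "compose (carrier (artin M\<^sub>1)) (artin_map M\<^sub>2 M\<^sub>3 h) (artin_map M\<^sub>1 M\<^sub>2 g) =
    artin_map M\<^sub>1 M\<^sub>3 (\<lambda>i. concat (map h (g i)))"
proof
  fix x
  have *: "concat (map h (concat (map g u))) = concat (map (\<lambda>i. concat (map h (g i))) u)" for u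
    by (induction u) auto
  show "compose (carrier (artin M\<^sub>1)) (artin_map M\<^sub>2 M\<^sub>3 h) (artin_map M\<^sub>1 M\<^sub>2 g) x =
    artin_map M\<^sub>1 M\<^sub>3 (\<lambda>i. concat (map h (g i))) x"
  proof (cases "x \<in> carrier (artin M\<^sub>1)")
    case True
    then obtain u where u: "u \<in> lists (index M\<^sub>1)" "x = artin_word M\<^sub>1 u"
      by (auto simp: carrier_artin)
    then show ?thesis
      using True word_map_lists[OF assms(1)]
      by (simp add: compose_def * artin_map_artin_word assms word_map_comp[OF assms])
  next
    case False
    then show ?thesis by (simp add: compose_def artin_map_def)
  qed
qed

lemma composite_of_artin_map:
  assumes "composite_of K M\<^sub>1 M\<^sub>2 (artin_map M\<^sub>1 M\<^sub>2 g)" "K M\<^sub>2 M\<^sub>3 (artin_map M\<^sub>2 M\<^sub>3 h)"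
    and "word_map M\<^sub>1 M\<^sub>2 g" "word_map M\<^sub>2 M\<^sub>3 h"
  shows "composite_of K M\<^sub>1 M\<^sub>3 (artin_map M\<^sub>1 M\<^sub>3 (\<lambda>i. concat (map h (g i))))"
  using composite_of.comp[OF assms(1,2)] compose_artin_map[OF assms(3,4)] by simp

section \<open>Braid relations between powers of two generators\<close>

text \<open>To words in two letters only the braid relation between these letters can be applied, so
  functions for \<open>x\<close> and \<open>y\<close> that satisfy it give an invariant; nothing is
  asked of the other generators.\<close>

lemma fold_braid_cong:
  assumes "coxeter_matrix M" "braid_cong M u v" "set u \<subseteq> {x, y}"
    and "\<And>m. entry M x y = enat m \<Longrightarrow> fold act (alt_word m x y) = fold act (alt_word m y x)"
  shows "fold act u = fold act v"
proof -
  have "fold act l = fold act r" if "(l, r) \<in> braid_rels M" "set l \<subseteq> {x, y}" for l r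
  proof -
    from that(1) obtain i j n where ij: "i \<in> index M" "j \<in> index M" "i \<noteq> j"
      "entry M i j = enat n" "l = alt_word n i j" "r = alt_word n j i"
      by (rule braid_relsE)
    then have "{i, j} \<subseteq> {x, y}"
      using that(2) coxeter_matrix_finite_entry[OF assms(1)] set_alt_word by metis
    then have "i = x \<and> j = y \<or> i = y \<and> j = x" using \<open>i \<noteq> j\<close> by auto
    moreover have "entry M x y = enat n"
      using calculation ij coxeter_matrixD(3)[OF assms(1)] by metis
    ultimately show ?thesis using assms(4) ij by metis
  qed
  then show ?thesis
    using word_cong_fold_on[OF assms(2) set_eq_of_braid_rels[OF assms(1)], of "{x, y}"] assms(3)
    by blast
qed

lemma alt_prod_length_eq_imp:
  assumes "length (alt_prod n u v) = length (alt_prod n v u)"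
  shows "even n \<or> length u = length v"
proof (rule disjCI)
  assume "length u \<noteq> length v"
  show "even n"
  proof (rule ccontr)
    assume "odd n"
    then obtain k where "n = 2 * k + 1" by (rule oddE)
    then show False using assms \<open>length u \<noteq> length v\<close>
      by (simp add: length_alt_prod algebra_simps)
  qed
qed

text \<open>When \<open>x\<close> and \<open>y\<close> commute, the number of letters
  \<open>x\<close> is invariant, and for odd \<open>n\<close> the two sides contain different
  numbers of blocks of \<open>x\<close>.\<close>

lemma commuting_powers_relation_even:
  assumes "coxeter_matrix M" "x \<noteq> y" "entry M x y = 2" "a > 0"
    and "braid_cong M (alt_prod n (replicate a x) (replicate b y))
      (alt_prod n (replicate b y) (replicate a x))"
  shows "even n"
proof (rule ccontr)
  define act where "act z = (if z = x then Suc else id)" for z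
  have fold_act: "fold act u k = count_list u x + k" for u k
    by (induction u arbitrary: k) (auto simp: act_def)
  have "entry M x y = enat 2" using assms(3) by (simp add: numeral_eq_enat)
  moreover have sub: "set (alt_prod n (replicate a x) (replicate b y)) \<subseteq> {x, y}"
    by (auto dest!: subsetD[OF set_alt_prod_subset])
  ultimately have eq: "fold act (alt_prod n (replicate a x) (replicate b y)) =
      fold act (alt_prod n (replicate b y) (replicate a x))"
    by (intro fold_braid_cong[OF assms(1,5) sub])
      (auto simp: act_def numeral_2_eq_2 alt_word_Suc split: if_splits)
  have "count_list (replicate k z) x = (if z = x then k else 0)" for k z
    by (induction k) auto
  moreover assume "odd n"
  then obtain k where "n = 2 * k + 1" by (rule oddE)
  moreover have "count_list (alt_prod n (replicate a x) (replicate b y)) x =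
      count_list (alt_prod n (replicate b y) (replicate a x)) x"
    using fun_cong[OF eq, of 0] unfolding fold_act by simp
  ultimately show False using assms(2,4) by (simp add: count_list_alt_prod)
qed

text \<open>The generators act on \<open>\<int>/m\<close> as the reflections \<open>k \<mapsto> -k\<close> and \<open>k \<mapsto> 1 - k\<close>.\<close>

lemma generators_relation_dvd:
  assumes "coxeter_matrix M" "x \<in> index M" "y \<in> index M" "x \<noteq> y" "entry M x y = enat m"
    and "braid_cong M (alt_word n x y) (alt_word n y x)"
  shows "m dvd n"
proof -
  define act where "act z k = (if z = x then - k else 1 - k) mod int m" for z k
  have m: "m \<ge> 2" using coxeter_matrix_finite_entry[OF assms(1-5)] .
  have minus_cong: "(a - b) mod int m = (c - d) mod int m"
    if "a mod int m = c mod int m" "b mod int m = d mod int m" for a b c d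
    using that by (rule mod_diff_cong)
  \<comment> \<open>The composite of the two reflections is a translation by one step, whose
    direction depends on which reflection comes first.\<close>
  have "fold act (alt_word n x y) k mod int m =
      (if even n then k + int (n div 2) else - k - int (n div 2)) mod int m
    \<and> fold act (alt_word n y x) k mod int m =
      (if even n then k - int (n div 2) else 1 - k + int (n div 2)) mod int m" for n k
  proof (induction n arbitrary: k)
    case (Suc n)
    have "(c + k mod int m) mod int m = (c + k) mod int m"
      "(c - k mod int m) mod int m = (c - k) mod int m"
      "(k mod int m - c) mod int m = (k - c) mod int m"
      "(- (k mod int m) - c) mod int m = (- k - c) mod int m"
      "(1 - k mod int m + c) mod int m = (1 - k + c) mod int m" for c k
      by (simp_all add: mod_simps)
        (metis (no_types, opaque_lifting) minus_cong mod_minus_cong mod_mod_trivial mod_add_cong)+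
    then show ?case
      using Suc[of "(- k) mod int m"] Suc[of "(1 - k) mod int m"] assms(4)
      by (auto simp: alt_word_Suc act_def algebra_simps)
  qed simp
  note val = this
  \<comment> \<open>In either parity the two closed forms differ by \<open>n\<close> up to
    sign.\<close>
  have diff: "fold act (alt_word n x y) k mod int m = fold act (alt_word n y x) k mod int m
      \<longleftrightarrow> m dvd n" for n k
  proof -
    have "even n \<Longrightarrow> (k + int (n div 2)) - (k - int (n div 2)) = int n"
      "odd n \<Longrightarrow> (1 - k + int (n div 2)) - (- k - int (n div 2)) = int n"
      by presburger+
    then show ?thesis
      using val[of n k] mod_eq_dvd_iff
      by (smt (verit, del_insts) dvd_diff_commute int_dvd_int_iff)
  qed
  \<comment> \<open>A non-empty word ends with a reduction modulo \<open>m\<close>, so congruent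
    results are equal and the braid relation holds for functions on all integers.\<close>
  have red: "fold act u k \<in> {0..<int m}" if "u \<noteq> []" for u k
    using that m by (cases u rule: rev_cases) (auto simp: act_def)
  have "fold act (alt_word m x y) k = fold act (alt_word m y x) k" for k
  proof -
    have "alt_word m x y \<noteq> []" "alt_word m y x \<noteq> []"
      using m by (metis length_alt_word list.size(3) not_numeral_le_zero)+
    then show ?thesis
      using diff[of m k] red[of "alt_word m x y" k] red[of "alt_word m y x" k] by simp
  qed
  then have "fold act (alt_word n x y) = fold act (alt_word n y x)"
    using assms(5) by (intro fold_braid_cong[OF assms(1,6) set_alt_word_subset]) auto
  then show ?thesis using diff[of n 0] by simp
qed

section \<open>The representation of the three strand braid monoid by SL(2,Z)\<close>

text \<open>The Chebyshev-like sequence \<open>p\<close> with \<open>U\<^sup>k = p\<^sub>k U - p\<^sub>k\<^sub>-\<^sub>1\<close> for a \<open>2\<times>2\<close> matrix \<open>U\<close> of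
  determinant \<open>1\<close> and trace \<open>t\<close>.\<close>

fun cheb :: "int \<Rightarrow> nat \<Rightarrow> int" where
  "cheb t 0 = 0"
| "cheb t (Suc 0) = 1"
| "cheb t (Suc (Suc k)) = t * cheb t (Suc k) - cheb t k"

text \<open>Trace 0 gives the sequence 0, 1, 0, -1 of period 4.\<close>

lemma cheb_0_eq_0_iff: "cheb 0 k = 0 \<longleftrightarrow> 2 dvd k"
proof -
  have "cheb 0 (2 * j) = 0 \<and> cheb 0 (2 * j + 1) = (-1) ^ j" for j
    by (induction j) auto
  then show ?thesis by (metis evenE oddE power_not_zero zero_neq_neg_one)
qed

text \<open>Trace -1 gives the sequence 0, 1, -1 of period 3.\<close>

lemma cheb_neg1_eq_0_iff: "cheb (-1) k = 0 \<longleftrightarrow> 3 dvd k"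
proof -
  have *: "cheb (-1) (3 * j) = 0 \<and> cheb (-1) (3 * j + 1) = 1 \<and> cheb (-1) (3 * j + 2) = -1" for j
    by (induction j) (auto simp: eval_nat_numeral)
  have "k = 3 * (k div 3) \<or> k = 3 * (k div 3) + 1 \<or> k = 3 * (k div 3) + 2" by presburger
  then show ?thesis using *[of "k div 3"]
    by (metis dvd_triv_left mult_div_mod_eq add_cancel_right_right dvd_imp_mod_0
      zero_neq_neg_one zero_neq_one)
qed

text \<open>The recursion makes the absolute values strictly increasing.\<close>

lemma cheb_neq_0:
  assumes "t \<le> -2" "k > 0"
  shows "cheb t k \<noteq> 0"
proof -
  have "\<bar>cheb t k\<bar> < \<bar>cheb t (Suc k)\<bar>" for k
  proof (induction k)
    case (Suc k)
    have "2 * \<bar>cheb t (Suc k)\<bar> \<le> \<bar>t * cheb t (Suc k)\<bar>"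
      unfolding abs_mult using assms(1) by (intro mult_right_mono) auto
    then show ?case using Suc by simp
  qed simp
  then show ?thesis using assms(2) by (metis abs_ge_zero abs_zero gr0_implies_Suc not_le)
qed

lemma fold_concat_replicate: "fold act (concat (replicate k w)) = (fold act w ^^ k)"
  by (induction k) (auto simp: funpow_swap1 fun_eq_iff)

text \<open>\<open>x\<close> and \<open>y\<close> act by elementary matrices satisfying the braid
  relation of length 3. Then \<open>x^a y\<close> has determinant 1 and trace \<open>2 - a\<close>,
  and equality of powers of \<open>x^a y\<close> and \<open>y x^a\<close> makes a term of
  \<open>cheb\<close> vanish: impossible for trace at most -2, a divisibility condition for traces 0
  and -1.\<close>

lemma braid3_power_relation:
  assumes "coxeter_matrix M" "x \<noteq> y" "entry M x y = 3" "a \<ge> 2" "n > 0"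
    and "braid_cong M (alt_prod n (replicate a x) [y]) (alt_prod n [y] (replicate a x))"
  shows "a \<in> {2, 3} \<and> 2 * a dvd n"
proof -
  have "even n"
    using alt_prod_length_eq_imp[OF braid_cong_length[OF assms(6)]] assms(4) by simp
  then obtain k' where k': "n = 2 * k'" by (rule evenE)
  then obtain k where k: "n = 2 * Suc k" using assms(5) by (cases k') auto
  define act :: "'a \<Rightarrow> int \<times> int \<Rightarrow> int \<times> int"
    where "act z = (\<lambda>(p, q). if z = x then (p + q, q) else (p, q - p))" for z
  have x_power: "(act x ^^ a) (p, q) = (p + int a * q, q)" for a p q
    by (induction a) (auto simp: act_def algebra_simps)
  have act_y: "act y (p, q) = (p, q - p)" for p q using assms(2) by (simp add: act_def)
  have "entry M x y = enat 3" using assms(3) by (simp add: numeral_eq_enat)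
  moreover have sub: "set (alt_prod n (replicate a x) [y]) \<subseteq> {x, y}"
    by (auto dest!: subsetD[OF set_alt_prod_subset])
  ultimately have "fold act (alt_prod n (replicate a x) [y]) =
      fold act (alt_prod n [y] (replicate a x))"
    using assms(2)
    by (intro fold_braid_cong[OF assms(1,6) sub])
      (auto simp: act_def alt_word_Suc numeral_3_eq_3 split: if_splits)
  then have eq: "(fold act (replicate a x @ [y]) ^^ Suc k) (1, 0) =
      (fold act (y # replicate a x) ^^ Suc k) (1, 0)"
    by (simp only: k alt_prod_double fold_concat_replicate append_Cons append_Nil)
  have XY: "fold act (replicate a x @ [y]) (p, q) = (p + int a * q, q - p - int a * q)" for p q
    by (simp add: x_power act_y)
  have YX: "fold act (y # replicate a x) (p, q) = (p + int a * (q - p), q - p)" for p q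
    by (simp add: x_power act_y)
  define c where "c = cheb (2 - int a)"
  have c: "c 0 = 0" "c (Suc 0) = 1" "c (Suc (Suc k)) = (2 - int a) * c (Suc k) - c k" for k
    by (simp_all add: c_def)
  have "(fold act (replicate a x @ [y]) ^^ Suc k) (1, 0) = (c (Suc k) - c k, - c (Suc k))"
  proof (induction k)
    case 0
    then show ?case by (simp add: x_power act_y c)
  next
    case (Suc k)
    then show ?case
      unfolding funpow.simps(2)[of "Suc k"] comp_apply
      by (simp only: XY c prod.inject) (simp add: algebra_simps)
  qed
  moreover have "(fold act (y # replicate a x) ^^ Suc k) (1, 0) =
      (c (Suc k) * (1 - int a) - c k, - c (Suc k))"
  proof (induction k)
    case 0
    then show ?case by (simp add: x_power act_y c)
  next
    case (Suc k)
    then show ?case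
      unfolding funpow.simps(2)[of "Suc k"] comp_apply
      by (simp only: YX c prod.inject) (simp add: algebra_simps)
  qed
  \<comment> \<open>The first coordinates differ by \<open>a\<close> times
    \<open>c (Suc k)\<close>.\<close>
  ultimately have zero: "cheb (2 - int a) (Suc k) = 0"
    using eq assms(4) unfolding c_def by (simp add: algebra_simps)
  show ?thesis
  proof (cases "a \<ge> 4")
    case True
    then show ?thesis using zero cheb_neq_0[of "2 - int a" "Suc k"] by simp
  next
    case False
    then consider "a = 2" | "a = 3" using assms(4) by linarith
    then show ?thesis
    proof cases
      case 1
      then have "2 dvd Suc k" using zero cheb_0_eq_0_iff[of "Suc k"] by simp
      from mult_dvd_mono[OF dvd_refl[of 2] this] show ?thesis using 1 k by simp
    next
      case 2
      then have "3 dvd Suc k" using zero cheb_neg1_eq_0_iff[of "Suc k"] by simp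
      from mult_dvd_mono[OF dvd_refl[of 2] this] show ?thesis using 2 k by simp
    qed
  qed
qed

section \<open>Words to which no braid relation applies\<close>

text \<open>Every block of \<open>x\<close> has at least two letters, so no \<open>x\<close> is
  isolated between two \<open>y\<close>. The claim on prefixes is what the induction needs when a
  block of \<open>y\<close> is prepended.\<close>

lemma not_sublist_alt_prod_replicate:
  assumes "x \<noteq> y" "a \<ge> 2" "b > 0"
  shows "\<not> sublist [y, x, y] (alt_prod n (replicate a x) (replicate b y)) \<and>
    \<not> sublist [y, x, y] (alt_prod n (replicate b y) (replicate a x)) \<and>
    \<not> prefix [x, y] (alt_prod n (replicate a x) (replicate b y))"
proof (induction n)
  case (Suc n)
  have 1: "sublist [y, x, y] (replicate k x @ w) = sublist [y, x, y] w" for k w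
    using assms(1) by (induction k) (auto simp: sublist_Cons_right)
  have 2: "\<not> sublist [y, x, y] (replicate k y @ w)"
    if "\<not> sublist [y, x, y] w" "\<not> prefix [x, y] w" for k w
  proof (induction k)
    case (Suc k)
    have "\<not> prefix [x, y] (replicate k y @ w)"
      using that(2) assms(1) by (cases k) auto
    then show ?case using Suc by (simp add: sublist_Cons_right)
  qed (use that in simp)
  obtain k where "a = Suc (Suc k)" using assms(2) by (metis add_2_eq_Suc le_iff_add)
  then have "\<not> prefix [x, y] (replicate a x @ w)" for w
    using assms(1) by simp
  then show ?case using Suc 1 2 by simp
qed (auto simp: sublist_code)

lemma sublist_alt_word:
  assumes "k + l \<le> n"
  shows "sublist (alt_word l (if even k then i else j) (if even k then j else i)) (alt_word n i j)"
proof -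
  have "alt_word (k + l) i j =
      alt_word k i j @ alt_word l (if even k then i else j) (if even k then j else i)" for k l i j
    using alt_prod_add[of k l "[i]" "[j]"] by (simp add: alt_prod_singleton)
  from this[of k l i j] this[of "k + l" "n - (k + l)" i j] assms obtain w
    where "alt_word n i j = alt_word k i j @
      alt_word l (if even k then i else j) (if even k then j else i) @ w"
    by fastforce
  then show ?thesis unfolding sublist_def by blast
qed

text \<open>A factor \<open>xyx\<close> requires an isolated \<open>y\<close>, and
  \<open>yxy\<close> an isolated \<open>x\<close>. A side of a braid relation of length at least 3
  contains one of them, of length at least 4 both. So no relation applies, the word is alone in its
  class, and the two sides begin with different letters.\<close>

lemma rigid_power_relation:
  assumes "coxeter_matrix M" "x \<in> index M" "y \<in> index M" "x \<noteq> y" "a > 0" "b > 0" "n > 0"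
    and "braid_cong M (alt_prod n (replicate a x) (replicate b y))
      (alt_prod n (replicate b y) (replicate a x))"
    and rigid: "\<And>m. entry M x y = enat m \<Longrightarrow>
      m \<ge> 3 \<and> a \<ge> 2 \<and> b \<ge> 2 \<or> m \<ge> 4 \<and> (a \<ge> 2 \<or> b \<ge> 2)"
  shows False
proof -
  let ?u = "alt_prod n (replicate a x) (replicate b y)"
  have no_alt: "\<not> sublist (alt_word m i j) ?u"
    if "{i, j} = {x, y}" "entry M x y = enat m" for i j m
  proof
    assume sub: "sublist (alt_word m i j) ?u"
    have yxy: False if "a \<ge> 2" "sublist [y, x, y] ?u"
      using not_sublist_alt_prod_replicate[OF assms(4) that(1) assms(6)] that(2) by blast
    have xyx: False if "b \<ge> 2" "sublist [x, y, x] ?u"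
      using not_sublist_alt_prod_replicate[OF assms(4)[symmetric] that(1) assms(5)] that(2) by blast
    have "sublist [i, j, i] ?u" if "m \<ge> 3"
      using sublist_alt_word[of 0 3 m i j] sub sublist_order.order_trans that
      by (force simp: eval_nat_numeral alt_word_Suc)
    moreover have "sublist [j, i, j] ?u" if "m \<ge> 4"
      using sublist_alt_word[of 1 3 m i j] sub sublist_order.order_trans that
      by (force simp: eval_nat_numeral alt_word_Suc)
    moreover have "i = x \<and> j = y \<or> i = y \<and> j = x"
      using \<open>{i, j} = {x, y}\<close> assms(4) by (metis doubleton_eq_iff)
    ultimately show False using rigid[OF that(2)] yxy xyx by auto
  qed
  have "?u = alt_prod n (replicate b y) (replicate a x)"
  proof (rule word_cong_no_relation[OF assms(8)])
    fix l r assume "(l, r) \<in> braid_rels M"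
    then obtain i j m where ij: "i \<in> index M" "j \<in> index M" "i \<noteq> j" "entry M i j = enat m"
      "l = alt_word m i j" "r = alt_word m j i"
      by (rule braid_relsE)
    have "m \<ge> 2" using coxeter_matrix_finite_entry[OF assms(1) ij(1-4)] .
    show "\<not> sublist l ?u \<and> \<not> sublist r ?u"
    proof (rule ccontr)
      assume "\<not> ?thesis"
      then have "sublist (alt_word m i j) ?u \<or> sublist (alt_word m j i) ?u" using ij by blast
      moreover from this have "{i, j} \<subseteq> set ?u"
        using set_mono_sublist set_alt_word[OF \<open>m \<ge> 2\<close>] by (metis insert_commute)
      then have "{i, j} \<subseteq> {x, y}"
        using set_alt_prod_subset[of n "replicate a x" "replicate b y"]
        by (auto dest!: subsetD[OF set_alt_prod_subset])
      then have eq: "{i, j} = {x, y}" "{j, i} = {x, y}" using ij(3) by auto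
      moreover have "entry M x y = enat m"
        using eq(1) ij coxeter_matrixD(3)[OF assms(1) assms(2,3)] by (metis doubleton_eq_iff)
      ultimately show False using no_alt by blast
    qed
  qed
  then have "hd ?u = hd (alt_prod n (replicate b y) (replicate a x))" by simp
  then show False using assms(4-7) by (cases n) (auto simp: hd_append)
qed

text \<open>The invariants cover commuting letters, exponents 1, and \<open>m = 3\<close> with one
  exponent 1; all other cases are rigid. The alternatives are exactly the finite values of the Tits
  entry for exponents \<open>a\<close> and \<open>b\<close>.\<close>

lemma power_relation_dvd:
  assumes "coxeter_matrix M" "x \<in> index M" "y \<in> index M" "x \<noteq> y" "a > 0" "b > 0" "n > 0"
    and "braid_cong M (alt_prod n (replicate a x) (replicate b y))
      (alt_prod n (replicate b y) (replicate a x))"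
  shows "(entry M x y = 2 \<and> even n) \<or>
    (\<exists>m. a * b = 1 \<and> entry M x y = enat m \<and> m dvd n) \<or>
    (entry M x y = 3 \<and> a * b \<in> {2, 3} \<and> 2 * a * b dvd n)"
proof (rule ccontr)
  assume neg: "\<not> ?thesis"
  have "entry M x y \<noteq> 2"
    using neg commuting_powers_relation_even[OF assms(1,4) _ assms(5,8)] by blast
  then have m3: "m \<ge> 3" if "entry M x y = enat m" for m
    using coxeter_matrix_finite_entry[OF assms(1-4) that] that
    by (cases "m = 2") (auto simp: numeral_eq_enat)
  have "a * b \<noteq> 1 \<or> entry M x y = \<infinity>"
  proof (rule ccontr)
    assume "\<not> ?thesis"
    then obtain m where "a = 1" "b = 1" "entry M x y = enat m" by auto
    then show False
      using neg generators_relation_dvd[OF assms(1-4), of m n] assms(8)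
      by (auto simp: alt_prod_singleton)
  qed
  then have ab: "a \<ge> 2 \<or> b \<ge> 2" if "entry M x y = enat m" for m
    using that assms(5,6) by (auto simp: not_le less_2_cases_iff)
  show False
  proof (rule rigid_power_relation[OF assms])
    fix m assume m: "entry M x y = enat m"
    show "m \<ge> 3 \<and> a \<ge> 2 \<and> b \<ge> 2 \<or> m \<ge> 4 \<and> (a \<ge> 2 \<or> b \<ge> 2)"
    proof (rule ccontr)
      assume contr: "\<not> ?thesis"
      then have m3: "m = 3" using m3[OF m] ab[OF m] by auto
      then have e: "entry M x y = 3" "entry M y x = 3"
        using m coxeter_matrixD(3)[OF assms(1-3)] by (auto simp: numeral_eq_enat)
      consider "b = 1" "a \<ge> 2" | "a = 1" "b \<ge> 2"
        using contr m3 ab[OF m] assms(5,6) by fastforce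
      then show False
      proof cases
        case 1
        then show False
          using neg e braid3_power_relation[OF assms(1,4) e(1) 1(2) assms(7)] assms(8) by auto
      next
        case 2
        then show False
          using neg e braid3_power_relation[OF assms(1) assms(4)[symmetric] e(2) 2(2) assms(7)]
            word_cong.sym[OF assms(8)] by auto
      qed
    qed
  qed
qed

section \<open>The geometric representation of a Coxeter group\<close>

text \<open>The contragredient of the geometric representation, on real-valued functions on the
  index set. The value \<open>0\<close> for \<open>m\<^sub>i\<^sub>j = \<infinity>\<close> is arbitrary, as no relation has to be respected.\<close>

definition cox_coeff :: "'a coxeter_data \<Rightarrow> 'a \<Rightarrow> 'a \<Rightarrow> real" where
  "cox_coeff M i j =
    (if i = j then 2 else case entry M i j of enat n \<Rightarrow> - 2 * cos (pi / real n) | \<infinity> \<Rightarrow> 0)"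

definition reflect :: "'a coxeter_data \<Rightarrow> 'a \<Rightarrow> ('a \<Rightarrow> real) \<Rightarrow> 'a \<Rightarrow> real" where
  "reflect M i g = (\<lambda>j. g j - cox_coeff M i j * g i)"

lemma reflect_reflect: "reflect M i (reflect M i g) = g"
  by (simp add: reflect_def cox_coeff_def fun_eq_iff)

lemma cox_coeff_2: "i \<noteq> j \<Longrightarrow> entry M i j = 2 \<Longrightarrow> cox_coeff M i j = 0"
  by (simp add: cox_coeff_def numeral_eq_enat)

text \<open>Two reflections compose to a rotation by \<open>2 * pi / n\<close> of a plane. In
  coordinates, the values met at \<open>i\<close> and \<open>j\<close> run through a sine sequence
  \<open>X\<close> of period \<open>2n\<close>, and the other coordinates return too because the
  sums of \<open>X\<close> over the even and over the odd places of a period vanish.\<close>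

lemma reflect_pair_power:
  assumes "coxeter_matrix M" "i \<in> index M" "j \<in> index M" "i \<noteq> j" "entry M i j = enat n"
  shows "((\<lambda>g. reflect M j (reflect M i g)) ^^ n) g = g"
proof -
  have n: "n \<ge> 2" using coxeter_matrix_finite_entry[OF assms] .
  define \<theta> where "\<theta> = pi / real n"
  define c where "c = 2 * cos \<theta>"
  have "0 < \<theta>" "\<theta> < pi" using n by (simp_all add: \<theta>_def divide_less_eq)
  then have sin: "sin \<theta> \<noteq> 0" using sin_gt_zero[of \<theta>] by simp
  have coeff: "cox_coeff M i j = - c" "cox_coeff M j i = - c"
    using assms coxeter_matrixD(3)[OF assms(1-3)] by (simp_all add: cox_coeff_def c_def \<theta>_def)
  have self: "cox_coeff M k k = 2" for k by (simp add: cox_coeff_def)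
  \<comment> \<open>\<open>X 0, X 1, \<dots>\<close> are the values at \<open>i, j, i, j, \<dots>\<close> just before the reflections at these.\<close>
  define X where "X t = ((g j + c * g i) * sin (t * \<theta>) - g i * sin ((t - 1) * \<theta>)) / sin \<theta>" for t
  have "sin ((t + 1) * \<theta>) + sin ((t - 1) * \<theta>) = c * sin (t * \<theta>)" for t
    by (simp add: c_def distrib_right left_diff_distrib sin_add sin_diff)
  note sin_rec = this[THEN eq_diff_eq[THEN iffD2]]
  have X_rec: "X (t + 1) = c * X t - X (t - 1)" for t
  proof -
    define s p where "s = sin (t * \<theta>)" and "p = sin ((t - 1) * \<theta>)"
    have "sin ((t - 1 - 1) * \<theta>) = c * p - s"
      using sin_rec[of "t - 1"] by (simp add: s_def p_def)
    then have 1: "X (t - 1) = ((g j + c * g i) * p - g i * (c * p - s)) / sin \<theta>"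
      by (simp add: X_def p_def)
    have 2: "X (t + 1) = ((g j + c * g i) * (c * s - p) - g i * s) / sin \<theta>"
      by (simp add: X_def sin_rec s_def p_def)
    have 3: "X t = ((g j + c * g i) * s - g i * p) / sin \<theta>"
      by (simp add: X_def s_def p_def)
    show ?thesis
      unfolding 1 2 3 by (simp add: add_divide_distrib diff_divide_distrib algebra_simps)
  qed
  have X_0: "X 0 = g i" using sin by (simp add: X_def)
  have X_neg1: "X (-1) = - g j"
    using sin sin_rec[of "-1"] by (simp add: X_def field_simps)
  have X_period: "X (t + 2 * real n) = X t" for t
  proof -
    have "real n * \<theta> = pi" using n by (simp add: \<theta>_def)
    then have "(t + 2 * real n) * \<theta> = t * \<theta> + 2 * pi"
      "(t + 2 * real n - 1) * \<theta> = (t - 1) * \<theta> + 2 * pi" for t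
      by (simp_all add: algebra_simps)
    then show ?thesis by (simp add: X_def)
  qed
  define G where "G k = ((\<lambda>g. reflect M j (reflect M i g)) ^^ k) g" for k
  have G_step: "G (Suc k) l = G k l - cox_coeff M i l * G k i
      - cox_coeff M j l * (G k j + c * G k i)" for k l
    by (simp add: G_def reflect_def coeff)
  \<comment> \<open>Reflecting at \<open>j\<close> negates the value there, so after
    \<open>k\<close> rounds \<open>j\<close> holds the negative of the value met last; hence the
    index \<open>2k - 1\<close> and the start \<open>X (-1) = - g j\<close>.\<close>
  have G_ij: "G k i = X (2 * real k) \<and> G k j = - X (2 * real k - 1)" for k
  proof (induction k)
    case 0
    then show ?case by (simp add: G_def X_0 X_neg1)
  next
    case (Suc k)
    have "X (2 * real k + 1) = c * X (2 * real k) - X (2 * real k - 1)"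
      "X (2 * real k + 2) = c * X (2 * real k + 1) - X (2 * real k)"
      using X_rec[of "2 * real k"] X_rec[of "2 * real k + 1"] by (simp_all add: add.assoc)
    moreover from this have fired: "G k j + c * G k i = X (2 * real k + 1)" using Suc by simp
    ultimately show ?case
      using Suc G_step[of k i] G_step[of k j] unfolding fired by (simp add: coeff self algebra_simps)
  qed
  \<comment> \<open>\<open>E\<close> and \<open>O'\<close> are the total multiples of the rows of
    \<open>i\<close> and \<open>j\<close> subtracted in \<open>n\<close> rounds.\<close>
  define E where "E = (\<Sum>k<n. X (2 * real k))"
  define O' where "O' = (\<Sum>k<n. X (2 * real k + 1))"
  have G_sum: "G m l = g l - cox_coeff M i l * (\<Sum>k<m. X (2 * real k))
      - cox_coeff M j l * (\<Sum>k<m. X (2 * real k + 1))" for m l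
  proof (induction m)
    case 0
    then show ?case by (simp add: G_def)
  next
    case (Suc m)
    have "G m i = X (2 * real m)" "G m j + c * G m i = X (2 * real m + 1)"
      using G_ij[of m] X_rec[of "2 * real m"] by simp_all
    then show ?case using Suc G_step[of m l] by (simp add: distrib_left)
  qed
  have shift: "(\<Sum>k<n. X (2 * real k + s + 2)) = (\<Sum>k<n. X (2 * real k + s))" for s
  proof -
    have "(\<Sum>k<n. X (2 * real (Suc k) + s) - X (2 * real k + s)) = X (2 * real n + s) - X (2 * real 0 + s)"
      by (rule sum_lessThan_telescope)
    then show ?thesis using X_period[of s] by (simp add: sum_subtractf algebra_simps)
  qed
  have "2 * E = (\<Sum>k<n. X (2 * real k + 0 + 2)) + E"
    using shift[of 0] by (simp add: E_def)
  also have "\<dots> = (\<Sum>k<n. c * X (2 * real k + 1))"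
    using X_rec[of "2 * real k + 1" for k]
    by (simp add: E_def sum.distrib[symmetric] add.assoc)
  finally have 1: "2 * E = c * O'" by (simp add: O'_def sum_distrib_left)
  have "2 * O' = O' + (\<Sum>k<n. X (2 * real k - 1))"
    using shift[of "-1"] by (simp add: O'_def add.commute)
  also have "\<dots> = (\<Sum>k<n. c * X (2 * real k))"
    using X_rec[of "2 * real k" for k] by (simp add: O'_def sum.distrib[symmetric])
  finally have 2: "2 * O' = c * E" by (simp add: E_def sum_distrib_left)
  \<comment> \<open>Both sums are annihilated by 4 minus the square of \<open>c\<close>, which is 4
    times a nonzero squared sine.\<close>
  have "c\<^sup>2 = 4 - 4 * (sin \<theta>)\<^sup>2" by (simp add: c_def power_mult_distrib cos_squared_eq)
  moreover have "4 * E = c\<^sup>2 * E" "4 * O' = c\<^sup>2 * O'"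
    using 1 2 by algebra+
  ultimately have "E = 0" "O' = 0" using sin by auto
  then have "G n l = g l" for l using G_sum[of n l] unfolding E_def O'_def by simp
  then show ?thesis unfolding G_def by (simp add: fun_eq_iff)
qed

abbreviation cox_cong :: "'a coxeter_data \<Rightarrow> 'a list \<Rightarrow> 'a list \<Rightarrow> bool" where
  "cox_cong M \<equiv> word_cong (index M) (coxeter_rels M)"

lemma fold_reflect_cox_cong:
  assumes "coxeter_matrix M" "cox_cong M u v"
  shows "fold (reflect M) u = fold (reflect M) v"
proof (rule word_cong_fold[OF assms(2)])
  fix l r assume "(l, r) \<in> coxeter_rels M"
  then obtain i j n where ij: "i \<in> index M" "j \<in> index M" "entry M i j = enat n"
    "l = concat (replicate n [i, j])" "r = []"
    by (auto simp: coxeter_rels_def)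
  have pow: "fold (reflect M) (concat (replicate k [i, j])) g =
      ((\<lambda>g. reflect M j (reflect M i g)) ^^ k) g" for k g
    by (induction k arbitrary: g) (simp_all add: funpow_Suc_right del: funpow.simps(2))
  show "fold (reflect M) l = fold (reflect M) r"
  proof (cases "i = j")
    case True
    then have "n = 1" using ij coxeter_matrixD(2)[OF assms(1)] by (simp add: one_enat_def)
    then show ?thesis using True ij by (simp add: fun_eq_iff reflect_reflect)
  next
    case False
    then show ?thesis
      using reflect_pair_power[OF assms(1) ij(1,2) False ij(3)] pow[of n] ij by (simp add: fun_eq_iff)
  qed
qed

section \<open>Longest elements of elementary abelian parabolic subgroups\<close>

text \<open>Every reflection other than that of \<open>p\<close> fixes the indicator function of
  \<open>p\<close>, whereas \<open>u\<close> negates its value at \<open>p\<close>, the coefficients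
  between commuting generators being 0. Congruent words act equally, so \<open>v\<close> contains
  \<open>p\<close>.\<close>

lemma commuting_word_set_subset:
  assumes "coxeter_matrix M" "distinct u"
    and comm: "\<And>i j. i \<in> set u \<Longrightarrow> j \<in> set u \<Longrightarrow> i \<noteq> j \<Longrightarrow> entry M i j = 2"
    and "cox_cong M u v"
  shows "set u \<subseteq> set v"
proof
  fix p assume p: "p \<in> set u"
  have fold_at: "fold (reflect M) w g p = (if p \<in> set w then - g p else g p)"
    if "distinct w" "set w \<subseteq> set u" for w g
    using that
  proof (induction w arbitrary: g)
    case (Cons s w)
    have "reflect M s g p = (if s = p then - g p else g p)"
      using comm[of s p] p Cons.prems by (auto simp: reflect_def cox_coeff_2) (simp add: cox_coeff_def)
    then show ?case using Cons by auto
  qed simp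
  show "p \<in> set v"
  proof (rule ccontr)
    assume "p \<notin> set v"
    define g :: "'a \<Rightarrow> real" where "g = (\<lambda>j. if j = p then 1 else 0)"
    have "fold (reflect M) w g = g" if "p \<notin> set w" for w
      using that by (induction w) (auto simp: reflect_def g_def)
    then have "fold (reflect M) u g p = g p"
      using fold_reflect_cox_cong[OF assms(1,4)] \<open>p \<notin> set v\<close> by simp
    then show False using fold_at[OF assms(2)] p by (simp add: g_def)
  qed
qed

lemma cox_cong_square:
  assumes "coxeter_matrix M" "i \<in> index M"
  shows "cox_cong M [i, i] []"
proof (rule word_cong.rel)
  have "entry M i i = enat 1" using coxeter_matrixD(2)[OF assms] by (simp add: one_enat_def)
  then have "(concat (replicate 1 [i, i]), []) \<in> coxeter_rels M"
    using assms(2) unfolding coxeter_rels_def by blast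
  then show "([i, i], []) \<in> coxeter_rels M" by simp
qed (use assms in auto)

text \<open>\<open>ij = jjij = jiijij = ji\<close>, where the last step removes
  \<open>ijij\<close>.\<close>

lemma cox_cong_commute:
  assumes "coxeter_matrix M" "i \<in> index M" "j \<in> index M" "entry M i j = 2"
  shows "cox_cong M [i, j] [j, i]"
proof -
  have "(concat (replicate 2 [i, j]), []) \<in> coxeter_rels M"
    using assms unfolding coxeter_rels_def numeral_eq_enat by blast
  then have rel: "cox_cong M [i, j, i, j] []"
    using assms by (intro word_cong.rel) (auto simp: numeral_2_eq_2)
  have "cox_cong M ([] @ [] @ [i, j]) ([] @ [j, j] @ [i, j])"
    using assms by (intro word_cong_context word_cong.sym[OF cox_cong_square]) auto
  also have "cox_cong M ([] @ [j, j] @ [i, j]) ([j] @ [i, i] @ [j, i, j])"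
    using word_cong_context[OF word_cong.sym[OF cox_cong_square[OF assms(1,2)]], of "[j]" "[j, i, j]"]
      assms by simp
  also have "cox_cong M ([j] @ [i, i] @ [j, i, j]) ([j, i] @ [] @ [])"
    using word_cong_context[OF rel, of "[j, i]" "[]"] assms by simp
  finally show ?thesis by simp
qed

lemma word_cong_move_letter:
  assumes "\<And>i. i \<in> set p \<Longrightarrow> word_cong S R [j, i] [i, j]" "p \<in> lists S" "j \<in> S"
  shows "word_cong S R (j # p) (p @ [j])"
  using assms
proof (induction p)
  case Nil
  then show ?case by (simp add: word_cong.refl)
next
  case (Cons i p)
  have "word_cong S R ([] @ [j, i] @ p) ([] @ [i, j] @ p)"
    using Cons.prems by (intro word_cong_context) auto
  also have "word_cong S R ([] @ [i, j] @ p) ([i] @ (p @ [j]))"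
    using word_cong_context[OF Cons.IH, of "[i]" "[]"] Cons.prems by simp
  finally show ?case by simp
qed

text \<open>Left multiplication by \<open>j\<close> toggles \<open>j\<close> in a subset of a
  commuting set: the letter moves to its place in the order of \<open>u\<close> and is either
  inserted there or cancels.\<close>

lemma cox_cong_toggle:
  assumes "coxeter_matrix M" "set u \<subseteq> index M" "distinct u" "j \<in> set u"
    and comm: "\<And>i j. i \<in> set u \<Longrightarrow> j \<in> set u \<Longrightarrow> i \<noteq> j \<Longrightarrow> entry M i j = 2"
  shows "cox_cong M (j # filter P u) (filter (P(j := \<not> P j)) u)"
proof -
  obtain p q where u: "u = p @ j # q" using split_list[OF assms(4)] by blast
  define Q where "Q = P(j := \<not> P j)"
  have pq: "filter Q p = filter P p" "filter Q q = filter P q" "Q j \<longleftrightarrow> \<not> P j"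
    using assms(3) u by (auto simp: Q_def intro!: filter_cong split: if_splits)
  have in_index: "j \<in> index M" "filter P p \<in> lists (index M)" "filter P q \<in> lists (index M)"
    using assms(2) u by (auto simp: in_lists_conv_set)
  have "cox_cong M [j, i] [i, j]" if "i \<in> set (filter P p)" for i
    using that u assms(2,3) comm[of j i] by (intro cox_cong_commute[OF assms(1)]) auto
  then have move: "cox_cong M (j # filter P p) (filter P p @ [j])"
    using in_index by (intro word_cong_move_letter) auto
  have "cox_cong M (j # filter P u) (filter Q u)"
  proof (cases "P j")
    case False
    then show ?thesis
      using word_cong_context[OF move, of "[]" "filter P q"] in_index by (simp add: u pq)
  next
    case True
    have "cox_cong M ((j # filter P p) @ (j # filter P q)) ((filter P p @ [j]) @ (j # filter P q))"
      using word_cong_context[OF move, of "[]" "j # filter P q"] in_index by simp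
    also have "cox_cong M \<dots> (filter P p @ filter P q)"
      using word_cong_context[OF cox_cong_square[OF assms(1) in_index(1)] in_index(2,3)] by simp
    finally show ?thesis using True by (simp add: u pq)
  qed
  then show ?thesis unfolding Q_def .
qed

text \<open>Normal form: toggling letter after letter turns any word over the letters of
  \<open>u\<close> into a subword of \<open>u\<close>.\<close>

lemma cox_cong_filter:
  assumes "coxeter_matrix M" "set u \<subseteq> index M" "distinct u"
    and comm: "\<And>i j. i \<in> set u \<Longrightarrow> j \<in> set u \<Longrightarrow> i \<noteq> j \<Longrightarrow> entry M i j = 2"
    and "v \<in> lists (set u)"
  shows "\<exists>P. cox_cong M v (filter P u)"
  using assms(5)
proof (induction v)
  case Nil
  have "cox_cong M [] (filter (\<lambda>_. False) u)" by (simp add: word_cong.refl)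
  then show ?case by blast
next
  case (Cons j v)
  then obtain P where "cox_cong M v (filter P u)" by auto
  then have "cox_cong M (j # v) (j # filter P u)"
    using word_cong_context[of "index M" "coxeter_rels M" v "filter P u" "[j]" "[]"] Cons.hyps assms(2)
    by auto
  then show ?case
    using cox_cong_toggle[OF assms(1-3) Cons.hyps(1) comm] word_cong.trans by blast
qed

text \<open>The generators are involutions, so the inverses included in \<open>generate\<close>
  contribute nothing new.\<close>

lemma parabolic_subgroup_eq:
  assumes "coxeter_matrix M" "J \<subseteq> index M"
  shows "parabolic_subgroup M J = word_class (index M) (coxeter_rels M) ` lists J"
proof
  interpret monoid "coxeter_group M"
    unfolding coxeter_group_def by (rule monoid_presented_monoid)
  have mult: "word_class (index M) (coxeter_rels M) u \<otimes>\<^bsub>coxeter_group M\<^esub>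
      word_class (index M) (coxeter_rels M) v = word_class (index M) (coxeter_rels M) (u @ v)"
    if "u \<in> lists J" "v \<in> lists J" for u v
    unfolding coxeter_group_def using that assms(2) lists_mono[OF assms(2)]
    by (intro mult_presented_monoid) auto
  have one: "\<one>\<^bsub>coxeter_group M\<^esub> = word_class (index M) (coxeter_rels M) []"
    by (simp add: coxeter_group_def one_presented_monoid)
  have inv: "inv\<^bsub>coxeter_group M\<^esub> cox_gen M j = cox_gen M j" if "j \<in> J" for j
  proof -
    have "j \<in> index M" using that assms(2) by blast
    then have square: "cox_gen M j \<otimes>\<^bsub>coxeter_group M\<^esub> cox_gen M j = \<one>\<^bsub>coxeter_group M\<^esub>"
      using mult[of "[j]" "[j]"] that cox_cong_square[OF assms(1)]
      by (simp add: cox_gen_def one word_class_eq_iff)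
    have "cox_gen M j \<in> carrier (coxeter_group M)"
      using \<open>j \<in> index M\<close>
      by (auto simp: coxeter_group_def carrier_presented_monoid cox_gen_def)
    then show ?thesis
      unfolding m_inv_def using square inv_unique by (intro the_equality) blast+
  qed
  show "parabolic_subgroup M J \<subseteq> word_class (index M) (coxeter_rels M) ` lists J"
  proof
    fix x assume "x \<in> parabolic_subgroup M J"
    then show "x \<in> word_class (index M) (coxeter_rels M) ` lists J"
      unfolding parabolic_subgroup_def
    proof (induction rule: generate.induct)
      case one
      then show ?case unfolding \<open>\<one>\<^bsub>coxeter_group M\<^esub> = _\<close> by (intro imageI) simp
    next
      case (incl h)
      then obtain j where "j \<in> J" "h = cox_gen M j" by blast
      then show ?case unfolding cox_gen_def by (auto intro!: imageI)
    next
      case (inv h)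
      then obtain j where "j \<in> J" "h = cox_gen M j" by blast
      then show ?case
        using \<open>\<And>j. j \<in> J \<Longrightarrow> inv\<^bsub>coxeter_group M\<^esub> cox_gen M j = cox_gen M j\<close>
        by (auto simp: cox_gen_def intro!: imageI)
    next
      case (eng h1 h2)
      then obtain u v where "u \<in> lists J" "v \<in> lists J"
        "h1 = word_class (index M) (coxeter_rels M) u" "h2 = word_class (index M) (coxeter_rels M) v"
        by (elim imageE)
      then show ?case using mult by (auto intro!: imageI)
    qed
  qed
  have "word_class (index M) (coxeter_rels M) v \<in> parabolic_subgroup M J" if "v \<in> lists J" for v
    using that
  proof (induction v)
    case Nil
    then show ?case using generate.one one by (metis parabolic_subgroup_def)
  next
    case (Cons j v)
    have "cox_gen M j \<otimes>\<^bsub>coxeter_group M\<^esub> word_class (index M) (coxeter_rels M) v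
        \<in> parabolic_subgroup M J"
      using Cons.IH Cons.hyps unfolding parabolic_subgroup_def
      by (blast intro: generate.eng generate.incl)
    then show ?case using mult[of "[j]" v] Cons.hyps by (simp add: cox_gen_def)
  qed
  then show "word_class (index M) (coxeter_rels M) ` lists J \<subseteq> parabolic_subgroup M J" by blast
qed

lemma cox_length_le:
  assumes "u \<in> lists (index M)" "cox_cong M u v"
  shows "cox_length (word_class (index M) (coxeter_rels M) u) \<le> length v"
  unfolding cox_length_def using assms(2) by (intro Least_le) (auto simp: word_class_def)

text \<open>Every element is represented by a subword of \<open>u\<close>, and proper subwords are
  shorter. Conversely a word for \<open>w\<close> contains all letters of \<open>u\<close> and
  cannot be shorter than \<open>u\<close>. Thus \<open>u\<close> is a reduced expression of the
  unique longest element.\<close>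

lemma commuting_word_longest:
  assumes "coxeter_matrix M" "set u \<subseteq> index M" "distinct u"
    and comm: "\<And>i j. i \<in> set u \<Longrightarrow> j \<in> set u \<Longrightarrow> i \<noteq> j \<Longrightarrow> entry M i j = 2"
  defines "w \<equiv> word_class (index M) (coxeter_rels M) u"
  shows "finite (parabolic_subgroup M (set u))"
    and "is_longest_element M (set u) w"
    and "is_T_elem M w (artin_word M u)"
proof -
  let ?cls = "word_class (index M) (coxeter_rels M)"
  have u: "u \<in> lists (index M)" using assms(2) by (auto simp: in_lists_conv_set)
  have in_index: "v \<in> lists (index M)" if "v \<in> lists (set u)" for v
    using that assms(2) by (auto simp: in_lists_conv_set)
  have filt: "\<exists>P. ?cls v = ?cls (filter P u) \<and> cox_cong M v (filter P u)"
    if "v \<in> lists (set u)" for v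
    using cox_cong_filter[OF assms(1-3) comm that] word_class_eq_iff[OF in_index[OF that]] by blast
  have "parabolic_subgroup M (set u) \<subseteq> ?cls ` {v. set v \<subseteq> set u \<and> length v \<le> length u}"
  proof
    fix x assume "x \<in> parabolic_subgroup M (set u)"
    then obtain v where "v \<in> lists (set u)" "x = ?cls v"
      unfolding parabolic_subgroup_eq[OF assms(1,2)] by blast
    then obtain P where "x = ?cls (filter P u)" using filt by blast
    then show "x \<in> ?cls ` {v. set v \<subseteq> set u \<and> length v \<le> length u}"
      by (auto intro!: imageI)
  qed
  then show "finite (parabolic_subgroup M (set u))"
    using finite_lists_length_le[of "set u" "length u"] by (meson finite_imageI finite_subset List.finite_set)
  have length: "cox_length w = length u"
    unfolding cox_length_def
  proof (rule Least_equality)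
    show "\<exists>v\<in>w. length v = length u"
      using in_word_class_self[OF u] unfolding w_def by blast
  next
    fix n assume "\<exists>v\<in>w. length v = n"
    then obtain v where v: "cox_cong M u v" "length v = n" by (auto simp: w_def word_class_def)
    have "length u = card (set u)" using assms(3) by (simp add: distinct_card)
    also have "\<dots> \<le> card (set v)"
      using commuting_word_set_subset[OF assms(1,3) comm v(1)] by (intro card_mono) auto
    also have "\<dots> \<le> n" using v(2) card_length by blast
    finally show "length u \<le> n" .
  qed
  show "is_longest_element M (set u) w"
    unfolding is_longest_element_def
  proof (intro conjI ballI impI)
    show "w \<in> parabolic_subgroup M (set u)"
      unfolding parabolic_subgroup_eq[OF assms(1,2)] w_def by (intro imageI) (simp add: in_lists_conv_set)
    fix x assume "x \<in> parabolic_subgroup M (set u)" "x \<noteq> w"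
    then obtain v where v: "v \<in> lists (set u)" "x = ?cls v"
      unfolding parabolic_subgroup_eq[OF assms(1,2)] by blast
    then obtain P where P: "x = ?cls (filter P u)" "cox_cong M v (filter P u)"
      using filt by blast
    then have "filter P u \<noteq> u" using \<open>x \<noteq> w\<close> by (auto simp: w_def)
    then have "length (filter P u) < length u"
      by (metis length_filter_less filter_True)
    then show "cox_length x < cox_length w"
      using cox_length_le[OF in_index[OF v(1)] P(2)] v(2) length by simp
  qed
  show "is_T_elem M w (artin_word M u)"
    unfolding is_T_elem_def reduced_expression_def
    using length in_word_class_self[OF u] w_def by metis
qed

text \<open>Braid relations preserve letters, so the support of the image of a generator is
  \<open>set (h i)\<close>, and a product of distinct commuting generators is \<open>T_w\<close> for
  the longest element. Words with at most one letter meet the conditions trivially, which covers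
  foldings, projections and inclusions.\<close>

lemma standard_hom_artin_map:
  assumes "coxeter_matrix M'" "coxeter_matrix M" "word_map M' M h"
    and "\<And>i. i \<in> index M' \<Longrightarrow> distinct (h i)"
    and "\<And>i x y. i \<in> index M' \<Longrightarrow> x \<in> set (h i) \<Longrightarrow> y \<in> set (h i) \<Longrightarrow> x \<noteq> y \<Longrightarrow> entry M x y = 2"
  shows "standard_hom M' M (artin_map M' M h)"
  unfolding standard_hom_def
proof (intro conjI ballI artin_hom_artin_map assms(1-3))
  fix i assume i: "i \<in> index M'"
  have hi: "h i \<in> lists (index M)" "set (h i) \<subseteq> index M"
    using word_mapD(1)[OF assms(3) i] by (auto simp: in_lists_conv_set)
  have "set v = set (h i)" if "v \<in> artin_word M (h i)" for v
    using braid_cong_set[OF assms(2), of "h i" v] that by (simp add: artin_word_def word_class_def)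
  moreover have "h i \<in> artin_word M (h i)"
    using hi(1) by (simp add: artin_word_def in_word_class_self)
  ultimately have "gen_support M' (artin_map M' M h) i = set (h i)"
    unfolding gen_support_def artin_map_gen[OF assms(3) i] by blast
  then show "finite (parabolic_subgroup M (gen_support M' (artin_map M' M h) i))"
    "\<exists>w. is_longest_element M (gen_support M' (artin_map M' M h) i) w \<and>
      is_T_elem M w (artin_map M' M h (artin_gen M' i))"
    using commuting_word_longest[OF assms(2) hi(2) assms(4)[OF i] assms(5)[OF i]]
    unfolding artin_map_gen[OF assms(3) i] by auto
qed

section \<open>The braid relations behind the Tits homomorphisms\<close>

text \<open>The two relations below hold in types \<open>A\<^sub>3\<close> (with central node \<open>z\<close>) and \<open>B\<^sub>3\<close>. The second
  one is applied to the product \<open>u\<close> of two leaves of \<open>D\<^sub>4\<close>, which satisfies the hypothesis on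
  \<open>u\<close> and \<open>z\<close> by the first one.\<close>

lemma word_cong_type_A3:
  assumes lists: "a \<in> lists S" "c \<in> lists S" "z \<in> lists S"
    and ac: "word_cong S R (a @ c) (c @ a)"
    and az: "word_cong S R (a @ z @ a) (z @ a @ z)"
    and cz: "word_cong S R (c @ z @ c) (z @ c @ z)"
  shows "word_cong S R (alt_prod 4 (a @ c) z) (alt_prod 4 z (a @ c))"
proof -
  \<comment> \<open>For single letters both sides are reduced expressions of the longest element of
    type \<open>A3\<close>, so braid moves must connect them; the same moves work for words.\<close>
  have "word_cong S R (a @ c @ z @ a @ c @ z) (c @ a @ z @ a @ c @ z)"
    using word_cong_context[OF ac, of "[]" "z @ a @ c @ z"] lists by simp
  also have "word_cong S R \<dots> (c @ z @ a @ z @ c @ z)"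
    using word_cong_context[OF az, of "c" "c @ z"] lists by simp
  also have "word_cong S R \<dots> (c @ z @ a @ c @ z @ c)"
    using word_cong_context[OF word_cong.sym[OF cz], of "c @ z @ a" "[]"] lists by simp
  also have "word_cong S R \<dots> (c @ z @ c @ a @ z @ c)"
    using word_cong_context[OF ac, of "c @ z" "z @ c"] lists by simp
  also have "word_cong S R \<dots> (z @ c @ z @ a @ z @ c)"
    using word_cong_context[OF cz, of "[]" "a @ z @ c"] lists by simp
  also have "word_cong S R \<dots> (z @ c @ a @ z @ a @ c)"
    using word_cong_context[OF word_cong.sym[OF az], of "z @ c" "c"] lists by simp
  also have "word_cong S R \<dots> (z @ a @ c @ z @ a @ c)"
    using word_cong_context[OF word_cong.sym[OF ac], of "z" "z @ a @ c"] lists by simp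
  finally show ?thesis by (simp add: eval_nat_numeral)
qed

lemma word_cong_type_B3:
  assumes lists: "u \<in> lists S" "c \<in> lists S" "z \<in> lists S"
    and uc: "word_cong S R (u @ c) (c @ u)"
    and cz: "word_cong S R (c @ z @ c) (z @ c @ z)"
    and uz: "word_cong S R (u @ z @ u @ z) (z @ u @ z @ u)"
  shows "word_cong S R (alt_prod 6 (u @ c) z) (alt_prod 6 z (u @ c))"
proof -
  have "word_cong S R (u @ c @ z @ u @ c @ z @ u @ c @ z) (u @ c @ z @ c @ u @ z @ u @ c @ z)"
    using word_cong_context[OF uc, of "u @ c @ z" "z @ u @ c @ z"] lists by simp
  also have "word_cong S R \<dots> (u @ z @ c @ z @ u @ z @ u @ c @ z)"
    using word_cong_context[OF cz, of "u" "u @ z @ u @ c @ z"] lists by simp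
  also have "word_cong S R \<dots> (u @ z @ c @ u @ z @ u @ z @ c @ z)"
    using word_cong_context[OF word_cong.sym[OF uz], of "u @ z @ c" "c @ z"] lists by simp
  also have "word_cong S R \<dots> (u @ z @ u @ c @ z @ u @ z @ c @ z)"
    using word_cong_context[OF word_cong.sym[OF uc], of "u @ z" "z @ u @ z @ c @ z"] lists by simp
  also have "word_cong S R \<dots> (u @ z @ u @ c @ z @ u @ c @ z @ c)"
    using word_cong_context[OF word_cong.sym[OF cz], of "u @ z @ u @ c @ z @ u" "[]"] lists by simp
  also have "word_cong S R \<dots> (u @ z @ u @ c @ z @ c @ u @ z @ c)"
    using word_cong_context[OF uc, of "u @ z @ u @ c @ z" "z @ c"] lists by simp
  also have "word_cong S R \<dots> (u @ z @ u @ z @ c @ z @ u @ z @ c)"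
    using word_cong_context[OF cz, of "u @ z @ u" "u @ z @ c"] lists by simp
  also have "word_cong S R \<dots> (z @ u @ z @ u @ c @ z @ u @ z @ c)"
    using word_cong_context[OF uz, of "[]" "c @ z @ u @ z @ c"] lists by simp
  also have "word_cong S R \<dots> (z @ u @ z @ c @ u @ z @ u @ z @ c)"
    using word_cong_context[OF uc, of "z @ u @ z" "z @ u @ z @ c"] lists by simp
  also have "word_cong S R \<dots> (z @ u @ z @ c @ z @ u @ z @ u @ c)"
    using word_cong_context[OF uz, of "z @ u @ z @ c" "c"] lists by simp
  also have "word_cong S R \<dots> (z @ u @ c @ z @ c @ u @ z @ u @ c)"
    using word_cong_context[OF word_cong.sym[OF cz], of "z @ u" "u @ z @ u @ c"] lists by simp
  also have "word_cong S R \<dots> (z @ u @ c @ z @ u @ c @ z @ u @ c)"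
    using word_cong_context[OF word_cong.sym[OF uc], of "z @ u @ c @ z" "z @ u @ c"] lists by simp
  finally show ?thesis by (simp add: eval_nat_numeral)
qed

lemma word_cong_commute_words:
  assumes "\<And>i j. i \<in> set u \<Longrightarrow> j \<in> set v \<Longrightarrow> word_cong S R [i, j] [j, i]"
    and "u \<in> lists S" "v \<in> lists S"
  shows "word_cong S R (u @ v) (v @ u)"
  using assms
proof (induction u)
  case Nil
  then show ?case by (simp add: word_cong.refl)
next
  case (Cons i u)
  have "word_cong S R ([i] @ (u @ v) @ []) ([i] @ (v @ u) @ [])"
    using Cons by (intro word_cong_context) auto
  also have "word_cong S R ([i] @ (v @ u) @ []) ([] @ (v @ [i]) @ u)"
    using word_cong_context[OF word_cong_move_letter[of v S R i], of "[]" u] Cons.prems by simp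
  finally show ?case by simp
qed

section \<open>Elementary homomorphisms\<close>

lemma enat_dvd_enat_iff:
  assumes "n > 0"
  shows "x dvd enat n \<longleftrightarrow> (\<exists>m. x = enat m \<and> m dvd n)"
proof
  assume "x dvd enat n"
  then obtain k where k: "enat n = x * k" by (rule dvdE)
  then show "\<exists>m. x = enat m \<and> m dvd n"
    using assms by (cases x; cases k) (auto split: if_splits simp: zero_enat_def)
next
  assume "\<exists>m. x = enat m \<and> m dvd n"
  then obtain m k where "x = enat m" "n = m * k" by (auto simp: dvd_def)
  then have "enat n = x * enat k" by simp
  then show "x dvd enat n" by (rule dvdI)
qed

lemma enat_dvd_infinity:
  assumes "x \<noteq> (0 :: enat)"
  shows "x dvd \<infinity>"
proof -
  have "x * \<infinity> = \<infinity>" using assms by (simp add: imult_is_infinity)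
  then show ?thesis by (metis dvd_triv_left)
qed

text \<open>If \<open>\<pi>\<close> identifies two letters, both sides of their relation become the
  same word. The image may be a proper subset of the target, so that inclusions are covered
  too.\<close>

lemma word_map_folding:
  assumes "coxeter_matrix N" "\<pi> ` index M \<subseteq> index N"
    and "\<And>i i'. i \<in> index M \<Longrightarrow> i' \<in> index M \<Longrightarrow> \<pi> i \<noteq> \<pi> i' \<Longrightarrow>
      entry N (\<pi> i) (\<pi> i') = entry M i i'"
  shows "word_map M N (\<lambda>i. [\<pi> i])"
  unfolding word_map_def alt_prod_singleton
proof (intro conjI ballI allI impI)
  fix i j n assume ij: "i \<in> index M" "j \<in> index M" "i \<noteq> j" "entry M i j = enat n"
  have \<pi>: "\<pi> i \<in> index N" "\<pi> j \<in> index N" using ij assms(2) by blast+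
  show "braid_cong N (alt_word n (\<pi> i) (\<pi> j)) (alt_word n (\<pi> j) (\<pi> i))"
  proof (cases "\<pi> i = \<pi> j")
    case True
    have "alt_word n (\<pi> j) (\<pi> j) \<in> lists (index N)"
      using \<pi>(2) set_alt_word_subset[of n "\<pi> j" "\<pi> j"] by (auto simp: in_lists_conv_set)
    then show ?thesis unfolding True by (rule word_cong.refl)
  next
    case False
    then show ?thesis using \<pi> ij assms(3) by (intro braid_cong_alt_word) auto
  qed
qed (use assms(2) in auto)

lemma folding_artin_map:
  assumes "coxeter_matrix M" "coxeter_matrix N" "\<pi> ` index M = index N" "foldable M \<pi>"
    and "\<And>i i'. i \<in> index M \<Longrightarrow> i' \<in> index M \<Longrightarrow> \<pi> i \<noteq> \<pi> i' \<Longrightarrow>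
      entry N (\<pi> i) (\<pi> i') = entry M i i'"
  shows "word_map M N (\<lambda>i. [\<pi> i])" and "folding M N (artin_map M N (\<lambda>i. [\<pi> i]))"
    and "standard_hom M N (artin_map M N (\<lambda>i. [\<pi> i]))"
proof -
  show word: "word_map M N (\<lambda>i. [\<pi> i])"
    using assms(2,3,5) by (intro word_map_folding) auto
  have "artin_map M N (\<lambda>i. [\<pi> i]) (artin_gen M i) = artin_gen N (\<pi> i)" if "i \<in> index M" for i
    using artin_map_gen[OF word that] by (simp add: artin_gen_def)
  then show "folding M N (artin_map M N (\<lambda>i. [\<pi> i]))"
    unfolding folding_def using artin_hom_artin_map[OF assms(1,2) word] assms(3-5) by blast
  show "standard_hom M N (artin_map M N (\<lambda>i. [\<pi> i]))"
    by (rule standard_hom_artin_map[OF assms(1,2) word]) auto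
qed

text \<open>A braid relation of length \<open>m\<close> implies those of all multiples of
  \<open>m\<close>, so divisibility of the entries is enough.\<close>

lemma tautological_artin_map:
  assumes "coxeter_matrix M" "coxeter_matrix N" "index M = index N"
    and dvd: "\<And>i j. i \<in> index N \<Longrightarrow> j \<in> index N \<Longrightarrow> i \<noteq> j \<Longrightarrow> entry N i j dvd entry M i j"
  shows "word_map M N (\<lambda>i. [i])" and "tautological_hom M N (artin_map M N (\<lambda>i. [i]))"
    and "standard_hom M N (artin_map M N (\<lambda>i. [i]))"
proof -
  show word: "word_map M N (\<lambda>i. [i])"
    unfolding word_map_def
  proof (intro conjI ballI allI impI)
    fix i j n assume ij: "i \<in> index M" "j \<in> index M" "i \<noteq> j" "entry M i j = enat n"
    have "n > 0" using coxeter_matrix_finite_entry[OF assms(1) ij] by simp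
    then obtain m where "entry N i j = enat m" "m dvd n"
      using dvd[of i j] ij assms(3) by (auto simp: enat_dvd_enat_iff)
    then have "braid_cong N (alt_prod m [i] [j]) (alt_prod m [j] [i])"
      using braid_cong_alt_word[of i N j m] ij assms(3) by (simp add: alt_prod_singleton)
    from word_cong_alt_prod_dvd[OF this \<open>m dvd n\<close>]
    show "braid_cong N (alt_prod n [i] [j]) (alt_prod n [j] [i])"
      using ij assms(3) by simp
  qed (use assms(3) in auto)
  \<comment> \<open>Any quotient serves as multiplier, with infinity for an infinite entry. It
    depends on the two entries alone, so symmetric matrices make it symmetric.\<close>
  define d where
    "d i j = (if entry M i j = \<infinity> then \<infinity> else SOME c. entry M i j = c * entry N i j)" for i j
  have nonzero: "entry M i j > 0" "entry N i j > 0" if "i \<in> index N" "j \<in> index N" for i j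
  proof -
    have "0 < entry K i j" if "coxeter_matrix K" "i \<in> index K" "j \<in> index K" for K
    proof (cases "i = j")
      case True
      then show ?thesis using coxeter_matrixD(2)[OF that(1,2)] by simp
    next
      case False
      then have "entry K i j \<noteq> 0" using coxeter_matrixD(4)[OF that] by auto
      then show ?thesis by simp
    qed
    then show "entry M i j > 0" "entry N i j > 0" using that assms(1-3) by auto
  qed
  have d: "entry M i j = d i j * entry N i j \<and> d i j = d j i" if "i \<in> index N" "j \<in> index N" for i j
  proof -
    have "entry N i j dvd entry M i j"
      using dvd that coxeter_matrixD(2)[OF assms(1)] coxeter_matrixD(2)[OF assms(2)] assms(3)
      by (cases "i = j") auto
    then have "\<exists>c. entry M i j = c * entry N i j" by (metis dvdE mult.commute)
    then have "entry M i j = (SOME c. entry M i j = c * entry N i j) * entry N i j"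
      by (rule someI_ex)
    moreover have "\<infinity> * entry N i j = \<infinity>"
      using nonzero(2)[OF that] by (simp add: imult_is_infinity)
    ultimately have "entry M i j = d i j * entry N i j"
      by (simp add: d_def)
    moreover have "d i j = d j i"
      using that assms(3) coxeter_matrixD(3)[OF assms(1), of i j] coxeter_matrixD(3)[OF assms(2), of i j]
      by (simp add: d_def)
    ultimately show ?thesis ..
  qed
  have "d i j > 0" if "i \<in> index N" "j \<in> index N" for i j
    using d[OF that] nonzero(1)[OF that] by (metis mult_zero_left not_gr_zero)
  moreover have "d i i = 1" if "i \<in> index N" for i
    using d[OF that that] that assms(3) coxeter_matrixD(2)[OF assms(1)] coxeter_matrixD(2)[OF assms(2)]
    by simp
  moreover have "artin_map M N (\<lambda>i. [i]) (artin_gen M i) = artin_gen N i" if "i \<in> index N" for i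
    using artin_map_gen[OF word, of i] that assms(3) by (simp add: artin_gen_def)
  ultimately show "tautological_hom M N (artin_map M N (\<lambda>i. [i]))"
    unfolding tautological_hom_def
    using artin_hom_artin_map[OF assms(1,2) word] assms(3) d[THEN conjunct1] d[THEN conjunct2]
    by (intro conjI exI[of _ d] ballI) assumption+
  show "standard_hom M N (artin_map M N (\<lambda>i. [i]))"
    by (rule standard_hom_artin_map[OF assms(1,2) word]) auto
qed

lemma coxeter_matrix_restrict:
  assumes "coxeter_matrix M" "J \<subseteq> index M"
  shows "coxeter_matrix (M\<lparr>index := J\<rparr>)"
  unfolding coxeter_matrix_def
proof (intro conjI ballI impI)
  show "finite (index (M\<lparr>index := J\<rparr>))"
    using finite_subset[OF assms(2)] coxeter_matrixD(1)[OF assms(1)] by simp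
qed (use coxeter_matrixD(2-4)[OF assms(1)] subsetD[OF assms(2)] in simp_all)

lemma inclusion_artin_map:
  assumes "coxeter_matrix M" "J \<subseteq> index M"
  defines "N \<equiv> M\<lparr>index := J\<rparr>"
  shows "word_map N M (\<lambda>i. [i])" and "natural_inclusion N M (artin_map N M (\<lambda>i. [i]))"
    and "standard_hom N M (artin_map N M (\<lambda>i. [i]))"
proof -
  have N: "coxeter_matrix N" unfolding N_def by (rule coxeter_matrix_restrict[OF assms(1,2)])
  show word: "word_map N M (\<lambda>i. [i])"
    using word_map_folding[OF assms(1), of "\<lambda>i. i" N] assms(2) by (simp add: N_def)
  have "is_submatrix N M J" using assms(2) by (simp add: is_submatrix_def N_def)
  moreover have "artin_map N M (\<lambda>i. [i]) (artin_gen N i) = artin_gen M i" if "i \<in> J" for i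
    using artin_map_gen[OF word, of i] that by (simp add: artin_gen_def N_def)
  ultimately show "natural_inclusion N M (artin_map N M (\<lambda>i. [i]))"
    unfolding natural_inclusion_def using artin_hom_artin_map[OF N assms(1) word] by blast
  show "standard_hom N M (artin_map N M (\<lambda>i. [i]))"
    by (rule standard_hom_artin_map[OF N assms(1) word]) auto
qed

text \<open>Deleting one of two letters turns their relation into an equality of powers of the
  other, with equal exponents because the length is even.\<close>

lemma projection_artin_map:
  assumes "coxeter_matrix M" "J \<subseteq> index M"
    and even: "\<And>i j. i \<in> index M - J \<Longrightarrow> j \<in> J \<Longrightarrow> 2 dvd entry M i j"
  defines "N \<equiv> M\<lparr>index := J\<rparr>" and "h \<equiv> \<lambda>i. if i \<in> J then [i] else []"
  shows "word_map M N h" and "parabolic_projection M N (artin_map M N h)"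
    and "standard_hom M N (artin_map M N h)"
proof -
  have N: "coxeter_matrix N" unfolding N_def by (rule coxeter_matrix_restrict[OF assms(1,2)])
  have index: "index N = J" by (simp add: N_def)
  show word: "word_map M N h"
    unfolding word_map_def
  proof (intro conjI ballI allI impI)
    fix i j n assume ij: "i \<in> index M" "j \<in> index M" "i \<noteq> j" "entry M i j = enat n"
    have lists: "alt_prod n (h i) (h j) \<in> lists (index N)"
      by (intro alt_prod_lists) (auto simp: h_def index)
    show "braid_cong N (alt_prod n (h i) (h j)) (alt_prod n (h j) (h i))"
    proof (cases "i \<in> J \<and> j \<in> J")
      case True
      then show ?thesis
        using ij braid_cong_alt_word[of i N j n] by (simp add: h_def alt_prod_singleton N_def)
    next
      case False
      have "alt_prod n (h i) (h j) = alt_prod n (h j) (h i)"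
      proof (cases "i \<in> J \<or> j \<in> J")
        case True
        have "2 dvd enat n"
          using even[of i j] even[of j i] True False ij coxeter_matrixD(3)[OF assms(1), of i j] by auto
        moreover have "n > 0" using coxeter_matrix_finite_entry[OF assms(1) ij] by simp
        ultimately have "even n" by (auto simp: enat_dvd_enat_iff numeral_eq_enat)
        then show ?thesis using False by (auto simp: h_def alt_prod_Nil)
      qed (simp add: h_def)
      then show ?thesis using word_cong.refl[OF lists] by simp
    qed
  qed (auto simp: h_def index)
  have "is_submatrix N M J" using assms(2) by (simp add: is_submatrix_def N_def)
  moreover have "artin_map M N h (artin_gen M i) =
      (if i \<in> J then artin_gen N i else \<one>\<^bsub>artin N\<^esub>)" if "i \<in> index M" for i
    using artin_map_gen[OF word that] by (simp add: artin_gen_def one_artin h_def)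
  ultimately show "parabolic_projection M N (artin_map M N h)"
    unfolding parabolic_projection_def using artin_hom_artin_map[OF assms(1) N word] assms(2) even
    by (intro conjI exI[of _ J]) auto
  show "standard_hom M N (artin_map M N h)"
    by (rule standard_hom_artin_map[OF assms(1) N word]) (auto simp: h_def split: if_splits)
qed

text \<open>Replace each vertex \<open>i\<close> by \<open>d i\<close> commuting copies:
  \<open>T_i\<close> goes to the product of its copies, and folding these together gives the power.
  The relations of the Tits matrix hold already before folding, and both factors are
  standard.\<close>

lemma tits_artin_map:
  fixes N' N :: "('a::infinite) coxeter_data"
  assumes "coxeter_matrix N'" "coxeter_matrix N" "index N' = index N"
    and pos: "\<And>i. i \<in> index N \<Longrightarrow> d i > 0"
    and entry: "\<And>i j. i \<in> index N \<Longrightarrow> j \<in> index N \<Longrightarrow> entry N' i j = tits_entry N d i j"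
  defines "h \<equiv> \<lambda>i. replicate (d i) i"
  shows "word_map N' N h" and "tits_hom N' N (artin_map N' N h)"
    and "\<exists>L h' \<pi>. coxeter_matrix L \<and> word_map N' L h' \<and> standard_hom N' L (artin_map N' L h') \<and>
      word_map L N (\<lambda>x. [\<pi> x]) \<and> standard_hom L N (artin_map L N (\<lambda>x. [\<pi> x])) \<and>
      (\<forall>i\<in>index N. concat (map (\<lambda>x. [\<pi> x]) (h' i)) = h i)"
proof -
  \<comment> \<open>The copies \<open>(i, k)\<close> are encoded in the infinite index type by
    \<open>\<phi>\<close>, and \<open>\<pi>\<close> forgets the number of the copy.\<close>
  define D where "D = (SIGMA i:index N. {..<d i})"
  have "finite D" using coxeter_matrixD(1)[OF assms(2)] by (simp add: D_def)
  then obtain \<phi> :: "'a \<times> nat \<Rightarrow> 'a" where \<phi>: "inj_on \<phi> D"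
    using arb_inj_on_finite_infinite by blast
  define \<pi> where "\<pi> x = fst (inv_into D \<phi> x)" for x
  have \<pi>_\<phi>: "\<pi> (\<phi> (i, k)) = i" if "i \<in> index N" "k < d i" for i k
    using that inv_into_f_f[OF \<phi>, of "(i, k)"] by (simp add: \<pi>_def D_def)
  have \<phi>_eq: "\<phi> (i, k) = \<phi> (i', k') \<longleftrightarrow> i = i' \<and> k = k'"
    if "i \<in> index N" "k < d i" "i' \<in> index N" "k' < d i'" for i k i' k'
    using that inj_on_eq_iff[OF \<phi>, of "(i, k)" "(i', k')"] by (simp add: D_def)
  define L where "L = \<lparr>index = \<phi> ` D,
    entry = (\<lambda>x y. if x = y then 1 else if \<pi> x = \<pi> y then 2 else entry N (\<pi> x) (\<pi> y))\<rparr>"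
  have \<pi>_image: "\<pi> ` index L = index N"
  proof
    show "\<pi> ` index L \<subseteq> index N" using \<pi>_\<phi> by (auto simp: L_def D_def)
    show "index N \<subseteq> \<pi> ` index L"
    proof
      fix i assume i: "i \<in> index N"
      then have "\<phi> (i, 0) \<in> index L" using pos by (auto simp: L_def D_def)
      then show "i \<in> \<pi> ` index L" using \<pi>_\<phi>[OF i pos[OF i]] by (metis imageI)
    qed
  qed
  then have \<pi>_index: "\<pi> x \<in> index N" if "x \<in> index L" for x using that by blast
  have entry_L: "entry L x y =
      (if x = y then 1 else if \<pi> x = \<pi> y then 2 else entry N (\<pi> x) (\<pi> y))" for x y
    by (simp add: L_def)
  have L: "coxeter_matrix L"
    unfolding coxeter_matrix_def entry_L
    using \<open>finite D\<close> coxeter_matrixD[OF assms(2)] \<pi>_index by (auto simp: L_def)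
  have "foldable L \<pi>" by (auto simp: foldable_def entry_L)
  note fold = folding_artin_map[OF L assms(2) \<pi>_image this]
  have fold_word: "word_map L N (\<lambda>x. [\<pi> x])"
    and fold_std: "standard_hom L N (artin_map L N (\<lambda>x. [\<pi> x]))"
    by (rule fold; auto simp: entry_L)+
  define h' where "h' i = map (\<lambda>k. \<phi> (i, k)) [0..<d i]" for i
  have h'_lists: "h' i \<in> lists (index L)" if "i \<in> index N" for i
    using that by (auto simp: h'_def in_lists_conv_set L_def D_def)
  have h'_\<pi>: "\<pi> x = i" if "i \<in> index N" "x \<in> set (h' i)" for i x
    using that \<pi>_\<phi> by (auto simp: h'_def)
  have h'_distinct: "distinct (h' i)" if "i \<in> index N" for i
    using that \<phi>_eq by (auto simp: h'_def distinct_map inj_on_def)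
  have h'_mem: "x \<in> index L" if "i \<in> index N" "x \<in> set (h' i)" for i x
    using h'_lists[OF that(1)] that(2) by (auto simp: in_lists_conv_set)
  have commute: "braid_cong L [x, y] [y, x]"
    if "x \<in> index L" "y \<in> index L" "x \<noteq> y" "entry L x y = 2" for x y
    using braid_cong_alt_word[OF that(1-3), of 2] that(4)
    by (simp add: numeral_eq_enat) (simp add: numeral_2_eq_2 alt_word_Suc)
  \<comment> \<open>With the only copy of \<open>j\<close> as centre and 2 or 3 copies of
    \<open>i\<close> around it, the diagram has type \<open>A3\<close> or \<open>D4\<close>.\<close>
  have star: "braid_cong L (alt_prod (2 * d i) (h' i) (h' j)) (alt_prod (2 * d i) (h' j) (h' i))"
    if ij: "i \<in> index N" "j \<in> index N" "i \<noteq> j" "entry N i j = 3" "d j = 1" "d i \<in> {2, 3}" for i j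
  proof -
    define z where "z = \<phi> (j, 0)"
    have hj: "h' j = [z]" using ij by (simp add: h'_def z_def)
    then have z: "z \<in> index L" "\<pi> z = j" using h'_mem h'_\<pi> ij(2) by auto
    have braid: "braid_cong L ([x] @ [z] @ [x]) ([z] @ [x] @ [z])" if "x \<in> set (h' i)" for x
    proof -
      have x: "x \<in> index L" "\<pi> x = i" using h'_mem h'_\<pi> ij(1) that by auto
      then have "entry L x z = enat 3" "x \<noteq> z"
        using z ij by (auto simp: entry_L numeral_eq_enat)
      from braid_cong_alt_word[OF x(1) z(1) this(2,1)] show ?thesis
        by (simp add: numeral_3_eq_3 alt_word_Suc)
    qed
    have comm: "braid_cong L [x, y] [y, x]" if "x \<in> set (h' i)" "y \<in> set (h' i)" "x \<noteq> y" for x y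
      using that h'_mem h'_\<pi> ij(1) by (intro commute) (auto simp: entry_L)
    show ?thesis
    proof (cases "d i = 2")
      case True
      define a b where "a = \<phi> (i, 0)" and "b = \<phi> (i, 1)"
      have hi: "h' i = [a, b]" using True by (simp add: h'_def a_def b_def numeral_2_eq_2)
      have "a \<noteq> b" using h'_distinct[OF ij(1)] by (simp add: hi)
      then show ?thesis
        using word_cong_type_A3[of "[a]" "index L" "[b]" "[z]" "braid_rels L"]
          braid comm[of a b] h'_lists[OF ij(1)] z True
        by (simp add: hi hj)
    next
      case False
      then have d: "d i = 3" using ij by simp
      define a b c where "a = \<phi> (i, 0)" and "b = \<phi> (i, 1)" and "c = \<phi> (i, 2)"
      have hi: "h' i = [a, b, c]"
        using d by (simp add: h'_def a_def b_def c_def upt_conv_Cons eval_nat_numeral)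
      have ne: "a \<noteq> b" "a \<noteq> c" "b \<noteq> c" using h'_distinct[OF ij(1)] by (auto simp: hi)
      have in_L: "a \<in> index L" "b \<in> index L" "c \<in> index L" using h'_mem[OF ij(1)] hi by auto
      \<comment> \<open>The product of the first two leaves behaves towards \<open>z\<close> like
        the end of the double bond in type \<open>B3\<close>.\<close>
      have "braid_cong L (alt_prod 4 ([a] @ [b]) [z]) (alt_prod 4 [z] ([a] @ [b]))"
        using braid comm[of a b] ne in_L z by (intro word_cong_type_A3) (auto simp: hi)
      then have "braid_cong L ([a, b] @ [z] @ [a, b] @ [z]) ([z] @ [a, b] @ [z] @ [a, b])"
        by (simp add: eval_nat_numeral)
      moreover have "braid_cong L ([a, b] @ [c]) ([c] @ [a, b])"
        using comm ne in_L by (intro word_cong_commute_words) (auto simp: hi)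
      ultimately have "braid_cong L (alt_prod 6 ([a, b] @ [c]) [z]) (alt_prod 6 [z] ([a, b] @ [c]))"
        using braid[of c] in_L z by (intro word_cong_type_B3) (auto simp: hi)
      then show ?thesis by (simp add: hi hj d)
    qed
  qed
  have word': "word_map N' L h'"
    unfolding word_map_def assms(3)
  proof (intro conjI ballI allI impI h'_lists)
    fix i j n assume ij: "i \<in> index N" "j \<in> index N" "i \<noteq> j" "entry N' i j = enat n"
    have n: "tits_entry N d i j = enat n" using ij entry by simp
    have ge2: "entry N i j \<ge> 2" using coxeter_matrixD(4)[OF assms(2) ij(1-3)] .
    consider (two) "entry N i j = 2" | (one) "entry N i j \<noteq> 2" "d i * d j = 1"
      | (three) "entry N i j = 3" "d i * d j \<in> {2, 3}" "n = 2 * d i * d j"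
      using n ij(3) ge2 by (auto simp: tits_entry_def split: if_splits)
    then show "braid_cong L (alt_prod n (h' i) (h' j)) (alt_prod n (h' j) (h' i))"
    proof cases
      case two
      then have "n = 2" using n ij(3) by (simp add: tits_entry_def numeral_eq_enat)
      have "braid_cong L (h' i @ h' j) (h' j @ h' i)"
      proof (rule word_cong_commute_words)
        fix x y assume "x \<in> set (h' i)" "y \<in> set (h' j)"
        then have "x \<in> index L" "y \<in> index L" "\<pi> x = i" "\<pi> y = j" using h'_mem h'_\<pi> ij by blast+
        then show "braid_cong L [x, y] [y, x]"
          using ij(3) two by (intro commute) (auto simp: entry_L)
      qed (use h'_lists ij in auto)
      then show ?thesis by (simp add: \<open>n = 2\<close> numeral_2_eq_2)
    next
      case one
      then have d: "d i = 1" "d j = 1" by auto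
      then have "entry N i j = enat n" using n ij(3) by (simp add: tits_entry_def)
      then have e: "entry L (\<phi> (i, 0)) (\<phi> (j, 0)) = enat n" "\<phi> (i, 0) \<noteq> \<phi> (j, 0)"
        using ij d \<pi>_\<phi>[of i 0] \<pi>_\<phi>[of j 0] by (auto simp: entry_L)
      have "\<phi> (i, 0) \<in> index L" "\<phi> (j, 0) \<in> index L" using ij d by (auto simp: L_def D_def)
      from braid_cong_alt_word[OF this e(2,1)] show ?thesis
        using d by (simp add: h'_def alt_prod_singleton)
    next
      case three
      \<comment> \<open>A product equal to 2 or 3 has a factor 1, so one of the two vertices is the
        centre of the star.\<close>
      have "0 < d i" "0 < d j" using pos ij by auto
      then have "d i \<le> d i * d j" "d j \<le> d i * d j" by simp_all
      moreover have "d i * d j \<le> 3" using three(2) by auto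
      ultimately have "d i \<le> 3" "d j \<le> 3" using le_trans by blast+
      then have "d i \<in> {1, 2, 3}" "d j \<in> {1, 2, 3}" using \<open>0 < d i\<close> \<open>0 < d j\<close> by auto
      then consider "d j = 1" "d i \<in> {2, 3}" | "d i = 1" "d j \<in> {2, 3}"
        using three(2) by fastforce
      then show ?thesis
      proof cases
        case 1
        then show ?thesis using star[of i j] ij three by simp
      next
        case 2
        then show ?thesis
          using word_cong.sym[OF star[of j i]] ij(1-3) three coxeter_matrixD(3)[OF assms(2) ij(1,2)] by simp
      qed
    qed
  qed
  have std': "standard_hom N' L (artin_map N' L h')"
    using h'_distinct h'_\<pi> assms(3)
    by (intro standard_hom_artin_map[OF assms(1) L word']) (auto simp: entry_L)
  have comp: "concat (map (\<lambda>x. [\<pi> x]) (h' i)) = h i" if "i \<in> index N" for i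
  proof -
    have "concat (map (\<lambda>x. [\<pi> x]) u) = map \<pi> u" for u by (induction u) auto
    moreover have "map \<pi> (h' i) = map (\<lambda>_. i) (h' i)" using h'_\<pi>[OF that] by simp
    moreover have "length (h' i) = d i" by (simp add: h'_def)
    ultimately show ?thesis by (simp only: map_replicate_const h_def)
  qed
  show word: "word_map N' N h"
    using word_map_comp[OF word' fold_word] comp assms(3) by (simp add: word_map_def)
  have "artin_map N' N h (artin_gen N' i) = artin_gen N i [^]\<^bsub>artin N\<^esub> d i" if "i \<in> index N" for i
    using artin_map_gen[OF word, of i] that assms(3) by (simp add: artin_gen_power h_def)
  then show "tits_hom N' N (artin_map N' N h)"
    unfolding tits_hom_def using artin_hom_artin_map[OF assms(1,2) word] assms(3) pos entry by blast
  show "\<exists>L h' \<pi>. coxeter_matrix L \<and> word_map N' L h' \<and> standard_hom N' L (artin_map N' L h') \<and>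
      word_map L N (\<lambda>x. [\<pi> x]) \<and> standard_hom L N (artin_map L N (\<lambda>x. [\<pi> x])) \<and>
      (\<forall>i\<in>index N. concat (map (\<lambda>x. [\<pi> x]) (h' i)) = h i)"
    using L word' std' fold_word fold_std comp by blast
qed

section \<open>Decomposition of light homomorphisms\<close>

text \<open>A word with at most one distinct letter is a power of a letter.\<close>

lemma light_hom_artin_map:
  assumes "light_hom M' M \<Phi>"
  obtains d f where "word_map M' M (\<lambda>i. replicate (d i) (f i))"
    and "\<Phi> = artin_map M' M (\<lambda>i. replicate (d i) (f i))"
proof -
  have hom: "artin_hom M' M \<Phi>" and card: "\<And>i. i \<in> index M' \<Longrightarrow> card (gen_support M' \<Phi> i) \<le> 1"
    using assms by (auto simp: light_hom_def)
  have M: "coxeter_matrix M" using hom by (simp add: artin_hom_def)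
  \<comment> \<open>Membership is required of the word, not of \<open>x\<close>: for
    \<open>n = 0\<close> the target may have no letter at all.\<close>
  have "\<exists>n x. replicate n x \<in> lists (index M) \<and> \<Phi> (artin_gen M' i) = artin_word M (replicate n x)"
    if i: "i \<in> index M'" for i
  proof -
    have "artin_gen M' i \<in> carrier (artin M')" using i by (simp add: artin_gen_def carrier_artin)
    then have "\<Phi> (artin_gen M' i) \<in> carrier (artin M)"
      using hom by (auto simp: artin_hom_def hom_def)
    then obtain u where u: "u \<in> lists (index M)" "\<Phi> (artin_gen M' i) = artin_word M u"
      unfolding carrier_artin by (elim imageE)
    have "set u \<subseteq> gen_support M' \<Phi> i"
      using in_word_class_self[OF u(1), of "braid_rels M"] u(2)
      by (auto simp: gen_support_def artin_word_def)
    moreover have "gen_support M' \<Phi> i \<subseteq> set u"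
      using braid_cong_set[OF M] u(2) by (auto simp: gen_support_def artin_word_def word_class_def)
    ultimately have "card (set u) \<le> 1" using card[OF i] by (metis subset_antisym)
    then have "x = hd u" if "x \<in> set u" for x
      using that card_le_Suc0_iff_eq[of "set u"] by (cases u) auto
    then have "u = replicate (length u) (hd u)"
      by (metis replicate_length_same)
    then show ?thesis using u by metis
  qed
  then obtain d f where df: "\<And>i. i \<in> index M' \<Longrightarrow> replicate (d i) (f i) \<in> lists (index M) \<and>
      \<Phi> (artin_gen M' i) = artin_word M (replicate (d i) (f i))"
    by metis
  show ?thesis
    by (rule that[of d f]) (rule artin_hom_eq_artin_map[OF hom], rule df, assumption)+
qed

lemma tits_entry_sym:
  assumes "entry M i j = entry M j i"
  shows "tits_entry M d i j = tits_entry M d j i"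
  using assms by (auto simp: tits_entry_def mult.commute mult.assoc mult.left_commute)

lemma tits_entry_ge_2:
  assumes "i \<noteq> j" "entry M i j \<ge> 2" "d i > 0" "d j > 0"
  shows "tits_entry M d i j \<ge> 2"
  using assms by (auto simp: tits_entry_def numeral_eq_enat mult.assoc)

lemma composite_of_replicate_artin_map:
  fixes M' M :: "('a::infinite) coxeter_data"
  assumes M': "coxeter_matrix M'" and M: "coxeter_matrix M"
    and word: "word_map M' M (\<lambda>i. replicate (d i) (f i))"
  shows "composite_of elementary_light_hom M' M (artin_map M' M (\<lambda>i. replicate (d i) (f i)))"
    and "composite_of standard_hom M' M (artin_map M' M (\<lambda>i. replicate (d i) (f i)))"
proof -

  \<comment> \<open>Constraints on letters and exponents from the braid relations\<close>
  define J where "J = {i \<in> index M'. d i > 0}"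
  have J: "J \<subseteq> index M'" "\<And>i. i \<in> J \<Longrightarrow> d i > 0" "\<And>i. i \<in> index M' - J \<Longrightarrow> d i = 0"
    by (auto simp: J_def)
  have f: "f i \<in> index M" if "i \<in> J" for i
    using word_mapD(1)[OF word, of i] that by (auto simp: J_def in_lists_conv_set)
  have rel: "braid_cong M (alt_prod n (replicate (d i) (f i)) (replicate (d j) (f j)))
      (alt_prod n (replicate (d j) (f j)) (replicate (d i) (f i))) \<and> n \<ge> 2"
    if "i \<in> index M'" "j \<in> index M'" "i \<noteq> j" "entry M' i j = enat n" for i j n
    using word_mapD(2)[OF word that] coxeter_matrix_finite_entry[OF M' that] by simp
  have even: "2 dvd entry M' i j" if "i \<in> index M'" "j \<in> index M'" "i \<noteq> j" "d i \<noteq> d j" for i j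
  proof (cases "entry M' i j")
    case (enat n)
    then have "even n"
      using rel[OF that(1-3)] alt_prod_length_eq_imp[OF braid_cong_length] that(4) by fastforce
    then show ?thesis using rel[OF that(1-3) enat] enat by (simp add: enat_dvd_enat_iff numeral_eq_enat)
  qed (simp add: enat_dvd_infinity)

  \<comment> \<open>The Tits matrix attached to letters and exponents\<close>
  define N\<^sub>3' where "N\<^sub>3' K = \<lparr>index = K,
    entry = (\<lambda>i j. if i = j then 1 else if f i = f j then 2 else entry M (f i) (f j))\<rparr>" for K :: "'a set"
  have entry\<^sub>3: "entry (N\<^sub>3' K) i j =
      (if i = j then 1 else if f i = f j then 2 else entry M (f i) (f j))" for K i j
    by (simp add: N\<^sub>3'_def)
  \<comment> \<open>\<open>t\<close> is the Tits entry for the pullback of \<open>M\<close> along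
    \<open>f\<close>, in which distinct vertices with the same letter commute. It does not depend on
    the index set, which is \<open>J\<close> here and the set \<open>K\<close> of representatives
    later.\<close>
  define t where "t = tits_entry (N\<^sub>3' J) d"
  have t_eq: "t = tits_entry (N\<^sub>3' K) d" for K
    by (intro ext) (simp only: t_def tits_entry_def entry\<^sub>3)
  have N\<^sub>3': "coxeter_matrix (N\<^sub>3' K)" if "K \<subseteq> J" for K
    unfolding coxeter_matrix_def entry\<^sub>3
    using finite_subset[OF subset_trans[OF that J(1)] coxeter_matrixD(1)[OF M']]
      coxeter_matrixD(3,4)[OF M] f that
    by (auto simp: N\<^sub>3'_def subset_iff)
  \<comment> \<open>Pairs with equal letter and exponent are left out: their entry in
    \<open>M'\<close> may be odd, while \<open>t\<close> is 2 for them.\<close>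
  have t_dvd: "t i j dvd entry M' i j"
    if ij: "i \<in> J" "j \<in> J" "i \<noteq> j" "f i \<noteq> f j \<or> d i \<noteq> d j" for i j
  proof (cases "f i = f j")
    case True
    then have "t i j = 2" using ij(3) by (simp add: t_def tits_entry_def entry\<^sub>3)
    then show ?thesis using even[of i j] ij True J(1) by auto
  next
    case False
    have e: "entry (N\<^sub>3' J) i j = entry M (f i) (f j)" using ij(3) False by (simp add: entry\<^sub>3)
    show ?thesis
    proof (cases "entry M' i j")
      case (enat n)
      have r: "braid_cong M (alt_prod n (replicate (d i) (f i)) (replicate (d j) (f j)))
          (alt_prod n (replicate (d j) (f j)) (replicate (d i) (f i)))" and n: "n > 0"
        using rel[OF subsetD[OF J(1) ij(1)] subsetD[OF J(1) ij(2)] ij(3) enat] by auto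
      from power_relation_dvd[OF M f[OF ij(1)] f[OF ij(2)] False J(2)[OF ij(1)] J(2)[OF ij(2)] n r]
      have "\<exists>m. t i j = enat m \<and> m dvd n"
      proof (elim disjE conjE exE)
        assume "entry M (f i) (f j) = 2" "even n"
        then show ?thesis
          using ij(3) by (intro exI[of _ 2]) (simp add: t_def tits_entry_def e numeral_eq_enat)
      next
        fix m assume "d i * d j = 1" "entry M (f i) (f j) = enat m" "m dvd n"
        then show ?thesis using ij(3) by (simp add: t_def tits_entry_def e)
      next
        assume "entry M (f i) (f j) = 3" "d i * d j \<in> {2, 3}" "2 * d i * d j dvd n"
        then show ?thesis
          using ij(3) by (auto simp: t_def tits_entry_def e)
      qed
      then show ?thesis using enat n by (simp add: enat_dvd_enat_iff)
    next
      case infinity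
      have "entry (N\<^sub>3' J) i j \<ge> 2"
        unfolding e by (rule coxeter_matrixD(4)[OF M f[OF ij(1)] f[OF ij(2)] False])
      then have "t i j \<ge> 2" unfolding t_def by (intro tits_entry_ge_2 ij(3) J(2) ij)
      then show ?thesis using infinity by (auto intro: enat_dvd_infinity)
    qed
  qed

  \<comment> \<open>Representatives and intermediate matrices\<close>
  define \<pi> where "\<pi> i = (SOME j. j \<in> J \<and> f j = f i \<and> d j = d i)" for i
  have \<pi>: "\<pi> i \<in> J \<and> f (\<pi> i) = f i \<and> d (\<pi> i) = d i" if "i \<in> J" for i
    unfolding \<pi>_def by (rule someI[of _ i]) (use that in simp)
  \<comment> \<open>The choice sees \<open>i\<close> only through its letter and exponent, so every
    fibre of \<open>(f, d)\<close> on \<open>J\<close> has exactly one representative in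
    \<open>K\<close>.\<close>
  have \<pi>_eq: "\<pi> i = \<pi> j" if "f i = f j" "d i = d j" for i j
    using that by (simp add: \<pi>_def)
  define K where "K = \<pi> ` J"
  have K: "K \<subseteq> J" using \<pi> by (auto simp: K_def)
  have K_inj: "i = j" if "i \<in> K" "j \<in> K" "f i = f j" "d i = d j" for i j
    using that \<pi> \<pi>_eq unfolding K_def by (metis (no_types, lifting) imageE)
  \<comment> \<open>\<open>N\<^sub>0\<close> drops the exponents 0. \<open>N\<^sub>1\<close> keeps
    the entries of \<open>M'\<close> inside a fibre of \<open>(f, d)\<close>, where folding ignores
    them, and has \<open>t\<close> elsewhere. \<open>N\<^sub>2\<close> has one vertex per fibre and
    is the Tits matrix of \<open>N\<^sub>3\<close>; \<open>N\<^sub>4\<close> is the part of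
    \<open>M\<close> that is reached.\<close>
  define N\<^sub>0 where "N\<^sub>0 = M'\<lparr>index := J\<rparr>"
  define N\<^sub>1 where "N\<^sub>1 = \<lparr>index = J,
    entry = (\<lambda>i j. if f i = f j \<and> d i = d j then entry M' i j else t i j)\<rparr>"
  define N\<^sub>2 where "N\<^sub>2 = N\<^sub>1\<lparr>index := K\<rparr>"
  define N\<^sub>3 where "N\<^sub>3 = N\<^sub>3' K"
  define N\<^sub>4 where "N\<^sub>4 = M\<lparr>index := f ` K\<rparr>"
  have entry\<^sub>1: "entry N\<^sub>1 i j = (if f i = f j \<and> d i = d j then entry M' i j else t i j)" for i j
    by (simp add: N\<^sub>1_def)
  have N\<^sub>0: "coxeter_matrix N\<^sub>0" unfolding N\<^sub>0_def by (rule coxeter_matrix_restrict[OF M' J(1)])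
  have t_sym: "t i j = t j i" if "i \<in> J" "j \<in> J" for i j
    unfolding t_def
    using coxeter_matrixD(3)[OF N\<^sub>3'[OF order_refl], of i j] that
    by (intro tits_entry_sym) (simp add: N\<^sub>3'_def)
  have t_ge_2: "t i j \<ge> 2" if "i \<in> J" "j \<in> J" "i \<noteq> j" for i j
    unfolding t_def
    using coxeter_matrixD(4)[OF N\<^sub>3'[OF order_refl], of i j] that
    by (intro tits_entry_ge_2 that(3) J(2)) (simp_all add: N\<^sub>3'_def)
  have N\<^sub>1: "coxeter_matrix N\<^sub>1"
    unfolding coxeter_matrix_def entry\<^sub>1
    using finite_subset[OF J(1) coxeter_matrixD(1)[OF M']] coxeter_matrixD(2-4)[OF M'] J(1) t_sym t_ge_2
    by (auto simp: N\<^sub>1_def subset_iff)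
  have N\<^sub>2: "coxeter_matrix N\<^sub>2"
    unfolding N\<^sub>2_def using K by (intro coxeter_matrix_restrict[OF N\<^sub>1]) (simp add: N\<^sub>1_def)
  have N\<^sub>3: "coxeter_matrix N\<^sub>3" unfolding N\<^sub>3_def by (rule N\<^sub>3'[OF K])
  have fK: "f ` K \<subseteq> index M" using f K by blast
  have N\<^sub>4: "coxeter_matrix N\<^sub>4" unfolding N\<^sub>4_def by (rule coxeter_matrix_restrict[OF M fK])

  \<comment> \<open>The six homomorphisms of the chain\<close>
  define h\<^sub>0 where "h\<^sub>0 = (\<lambda>i. if i \<in> J then [i] else [])"
  have proj: "2 dvd entry M' i j" if "i \<in> index M' - J" "j \<in> J" for i j
    using that by (intro even) (auto simp: J_def)
  have step\<^sub>0: "word_map M' N\<^sub>0 h\<^sub>0" "parabolic_projection M' N\<^sub>0 (artin_map M' N\<^sub>0 h\<^sub>0)"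
    "standard_hom M' N\<^sub>0 (artin_map M' N\<^sub>0 h\<^sub>0)"
    unfolding N\<^sub>0_def h\<^sub>0_def by (rule projection_artin_map[OF M' J(1)], rule proj; assumption)+
  have dvd: "entry N\<^sub>1 i j dvd entry N\<^sub>0 i j" if "i \<in> index N\<^sub>1" "j \<in> index N\<^sub>1" "i \<noteq> j" for i j
    using t_dvd[of i j] that by (simp add: N\<^sub>1_def N\<^sub>0_def)
  have index01: "index N\<^sub>0 = index N\<^sub>1" by (simp add: N\<^sub>0_def N\<^sub>1_def)
  have step\<^sub>1: "word_map N\<^sub>0 N\<^sub>1 (\<lambda>i. [i])"
    "tautological_hom N\<^sub>0 N\<^sub>1 (artin_map N\<^sub>0 N\<^sub>1 (\<lambda>i. [i]))"
    "standard_hom N\<^sub>0 N\<^sub>1 (artin_map N\<^sub>0 N\<^sub>1 (\<lambda>i. [i]))"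
    by (rule tautological_artin_map[OF N\<^sub>0 N\<^sub>1 index01], rule dvd; assumption)+
  have t_cong: "t i j = t i' j'"
    if "f i = f i'" "d i = d i'" "f j = f j'" "d j = d j'" "i \<noteq> j" "i' \<noteq> j'" for i j i' j'
    using that by (auto simp: t_def tits_entry_def entry\<^sub>3)
  have step\<^sub>2: "word_map N\<^sub>1 N\<^sub>2 (\<lambda>i. [\<pi> i])" "folding N\<^sub>1 N\<^sub>2 (artin_map N\<^sub>1 N\<^sub>2 (\<lambda>i. [\<pi> i]))"
    "standard_hom N\<^sub>1 N\<^sub>2 (artin_map N\<^sub>1 N\<^sub>2 (\<lambda>i. [\<pi> i]))"
  proof -
    have img: "\<pi> ` index N\<^sub>1 = index N\<^sub>2" by (simp add: N\<^sub>1_def N\<^sub>2_def K_def)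
    have ne: "f i \<noteq> f i' \<or> d i \<noteq> d i'" if "\<pi> i \<noteq> \<pi> i'" for i i' using that \<pi>_eq by blast
    have fold: "foldable N\<^sub>1 \<pi>"
      unfolding foldable_def
    proof (intro ballI impI)
      fix i i' i'' assume i: "i \<in> index N\<^sub>1" "i' \<in> index N\<^sub>1" "i'' \<in> index N\<^sub>1"
        "\<pi> i' = \<pi> i'' \<and> \<pi> i'' \<noteq> \<pi> i"
      then have "f i' = f i''" "d i' = d i''" using \<pi>[of i'] \<pi>[of i''] by (simp_all add: N\<^sub>1_def)
      moreover have "f i \<noteq> f i' \<or> d i \<noteq> d i'" "f i \<noteq> f i'' \<or> d i \<noteq> d i''" using i(4) ne by metis+
      ultimately show "entry N\<^sub>1 i i' = entry N\<^sub>1 i i''"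
        using t_cong[of i i i' i''] unfolding entry\<^sub>1 by auto
    qed
    have entry: "entry N\<^sub>2 (\<pi> i) (\<pi> i') = entry N\<^sub>1 i i'"
      if "i \<in> index N\<^sub>1" "i' \<in> index N\<^sub>1" "\<pi> i \<noteq> \<pi> i'" for i i'
    proof -
      have "i \<in> J" "i' \<in> J" using that by (simp_all add: N\<^sub>1_def)
      then have "t (\<pi> i) (\<pi> i') = t i i'" using \<pi> that(3) by (intro t_cong) auto
      then show ?thesis using \<pi> \<open>i \<in> J\<close> \<open>i' \<in> J\<close> ne[OF that(3)] by (auto simp: N\<^sub>2_def entry\<^sub>1)
    qed
    show "word_map N\<^sub>1 N\<^sub>2 (\<lambda>i. [\<pi> i])" "folding N\<^sub>1 N\<^sub>2 (artin_map N\<^sub>1 N\<^sub>2 (\<lambda>i. [\<pi> i]))"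
      "standard_hom N\<^sub>1 N\<^sub>2 (artin_map N\<^sub>1 N\<^sub>2 (\<lambda>i. [\<pi> i]))"
      by (rule folding_artin_map[OF N\<^sub>1 N\<^sub>2 img fold], rule entry; assumption)+
  qed
  have index23: "index N\<^sub>2 = index N\<^sub>3" by (simp add: N\<^sub>2_def N\<^sub>3_def N\<^sub>3'_def)
  have d_pos: "d i > 0" if "i \<in> index N\<^sub>3" for i
    using that K J(2) by (auto simp: N\<^sub>3_def N\<^sub>3'_def)
  have entry\<^sub>2: "entry N\<^sub>2 i j = tits_entry N\<^sub>3 d i j" if "i \<in> index N\<^sub>3" "j \<in> index N\<^sub>3" for i j
  proof (cases "i = j")
    case True
    then show ?thesis
      using that K J(1) coxeter_matrixD(2)[OF M', of i]
      by (auto simp: N\<^sub>2_def entry\<^sub>1 tits_entry_def N\<^sub>3_def N\<^sub>3'_def)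
  next
    case False
    have "i \<in> K" "j \<in> K" using that by (simp_all add: N\<^sub>3_def N\<^sub>3'_def)
    then show ?thesis
      using K_inj[of i j] False t_eq[of K] by (auto simp: N\<^sub>2_def entry\<^sub>1 N\<^sub>3_def)
  qed
  define h\<^sub>3 where "h\<^sub>3 i = replicate (d i) i" for i
  have step\<^sub>3: "word_map N\<^sub>2 N\<^sub>3 h\<^sub>3" "tits_hom N\<^sub>2 N\<^sub>3 (artin_map N\<^sub>2 N\<^sub>3 h\<^sub>3)"
    "\<exists>L h' \<pi>. coxeter_matrix L \<and> word_map N\<^sub>2 L h' \<and> standard_hom N\<^sub>2 L (artin_map N\<^sub>2 L h') \<and>
      word_map L N\<^sub>3 (\<lambda>x. [\<pi> x]) \<and> standard_hom L N\<^sub>3 (artin_map L N\<^sub>3 (\<lambda>x. [\<pi> x])) \<and>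
      (\<forall>i\<in>index N\<^sub>3. concat (map (\<lambda>x. [\<pi> x]) (h' i)) = h\<^sub>3 i)"
    unfolding h\<^sub>3_def
    by (rule tits_artin_map[OF N\<^sub>2 N\<^sub>3 index23]; (rule d_pos | rule entry\<^sub>2); assumption)+
  have step\<^sub>4: "word_map N\<^sub>3 N\<^sub>4 (\<lambda>i. [f i])" "folding N\<^sub>3 N\<^sub>4 (artin_map N\<^sub>3 N\<^sub>4 (\<lambda>i. [f i]))"
    "standard_hom N\<^sub>3 N\<^sub>4 (artin_map N\<^sub>3 N\<^sub>4 (\<lambda>i. [f i]))"
  proof -
    have img: "f ` index N\<^sub>3 = index N\<^sub>4" by (simp add: N\<^sub>3_def N\<^sub>3'_def N\<^sub>4_def)
    have fold: "foldable N\<^sub>3 f" by (auto simp: foldable_def N\<^sub>3_def entry\<^sub>3)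
    have entry: "entry N\<^sub>4 (f i) (f i') = entry N\<^sub>3 i i'" if "f i \<noteq> f i'" for i i'
      using that by (auto simp: N\<^sub>4_def N\<^sub>3_def entry\<^sub>3)
    show "word_map N\<^sub>3 N\<^sub>4 (\<lambda>i. [f i])" "folding N\<^sub>3 N\<^sub>4 (artin_map N\<^sub>3 N\<^sub>4 (\<lambda>i. [f i]))"
      "standard_hom N\<^sub>3 N\<^sub>4 (artin_map N\<^sub>3 N\<^sub>4 (\<lambda>i. [f i]))"
      by (rule folding_artin_map[OF N\<^sub>3 N\<^sub>4 img fold], rule entry, assumption)+
  qed
  note step\<^sub>5 = inclusion_artin_map[OF M fK, folded N\<^sub>4_def]

  \<comment> \<open>Composition along the chain\<close>
  define h\<^sub>2 where "h\<^sub>2 i = concat (map (\<lambda>i. [\<pi> i]) (concat (map (\<lambda>i. [i]) (h\<^sub>0 i))))" for i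
  have word\<^sub>2: "word_map M' N\<^sub>2 h\<^sub>2"
    unfolding h\<^sub>2_def by (rule word_map_comp[OF word_map_comp[OF step\<^sub>0(1) step\<^sub>1(1)] step\<^sub>2(1)])
  have compose\<^sub>2: "composite_of C M' N\<^sub>2 (artin_map M' N\<^sub>2 h\<^sub>2)"
    if "C M' N\<^sub>0 (artin_map M' N\<^sub>0 h\<^sub>0)" "C N\<^sub>0 N\<^sub>1 (artin_map N\<^sub>0 N\<^sub>1 (\<lambda>i. [i]))"
      "C N\<^sub>1 N\<^sub>2 (artin_map N\<^sub>1 N\<^sub>2 (\<lambda>i. [\<pi> i]))" for C
    unfolding h\<^sub>2_def
    by (rule composite_of_artin_map[of C, OF composite_of_artin_map[of C, OF composite_of.single[of C, OF that(1)]
            that(2) step\<^sub>0(1) step\<^sub>1(1)] that(3) word_map_comp[OF step\<^sub>0(1) step\<^sub>1(1)] step\<^sub>2(1)])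
  \<comment> \<open>Only the Tits step differs between the two classes \<open>C\<close>; it enters
    through a map \<open>h\<close> into \<open>N\<^sub>3\<close> that has to agree with
    \<open>h\<^sub>3\<close> after \<open>h\<^sub>2\<close>.\<close>
  have compose: "composite_of C M' M (artin_map M' M (\<lambda>i. replicate (d i) (f i)))"
    if "composite_of C M' N\<^sub>3 (artin_map M' N\<^sub>3 h)" "word_map M' N\<^sub>3 h"
      and "\<And>i. i \<in> index M' \<Longrightarrow> h i = concat (map h\<^sub>3 (h\<^sub>2 i))"
      and "C N\<^sub>3 N\<^sub>4 (artin_map N\<^sub>3 N\<^sub>4 (\<lambda>i. [f i]))" "C N\<^sub>4 M (artin_map N\<^sub>4 M (\<lambda>i. [i]))" for C h
  proof -
    note h = that(3)
    define g where "g i = concat (map (\<lambda>i. [i]) (concat (map (\<lambda>i. [f i]) (h i))))" for i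
    have "composite_of C M' M (artin_map M' M g)"
      unfolding g_def
      by (rule composite_of_artin_map[of C, OF composite_of_artin_map[of C, OF that(1,4,2) step\<^sub>4(1)]
              that(5) word_map_comp[OF that(2) step\<^sub>4(1)] step\<^sub>5(1)])
    moreover have "g i = replicate (d i) (f i)" if i: "i \<in> index M'" for i
    proof (cases "i \<in> J")
      case True
      then have "h i = replicate (d (\<pi> i)) (\<pi> i)"
        using h[OF i] by (simp add: h\<^sub>2_def h\<^sub>0_def h\<^sub>3_def)
      then show ?thesis using \<pi>[OF True] by (simp add: g_def map_replicate_const)
    next
      case False
      then show ?thesis
        using h[OF i] J(3)[of i] i by (simp add: g_def h\<^sub>2_def h\<^sub>0_def)
    qed
    then have "artin_map M' M (\<lambda>i. replicate (d i) (f i)) = artin_map M' M g"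
      by (intro artin_map_cong[OF _ word M' M]) simp
    ultimately show ?thesis by simp
  qed
  have "composite_of elementary_light_hom M' N\<^sub>2 (artin_map M' N\<^sub>2 h\<^sub>2)"
    using step\<^sub>0(2) step\<^sub>1(2) step\<^sub>2(2) by (intro compose\<^sub>2) (simp_all add: elementary_light_hom_def)
  from composite_of_artin_map[of elementary_light_hom, OF this _ word\<^sub>2 step\<^sub>3(1)]
  have "composite_of elementary_light_hom M' N\<^sub>3
      (artin_map M' N\<^sub>3 (\<lambda>i. concat (map h\<^sub>3 (h\<^sub>2 i))))"
    using step\<^sub>3(2) by (simp add: elementary_light_hom_def)
  from compose[OF this word_map_comp[OF word\<^sub>2 step\<^sub>3(1)] HOL.refl]
  show "composite_of elementary_light_hom M' M (artin_map M' M (\<lambda>i. replicate (d i) (f i)))"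
    using step\<^sub>4(2) step\<^sub>5(2) by (simp add: elementary_light_hom_def)

  \<comment> \<open>Standard homomorphisms: the Tits step through the matrix of copies\<close>
  obtain L h' \<rho> where L: "coxeter_matrix L" "word_map N\<^sub>2 L h'" "standard_hom N\<^sub>2 L (artin_map N\<^sub>2 L h')"
    "word_map L N\<^sub>3 (\<lambda>x. [\<rho> x])" "standard_hom L N\<^sub>3 (artin_map L N\<^sub>3 (\<lambda>x. [\<rho> x]))"
    and comp: "\<And>i. i \<in> index N\<^sub>3 \<Longrightarrow> concat (map (\<lambda>x. [\<rho> x]) (h' i)) = h\<^sub>3 i"
    using step\<^sub>3(3) by blast
  have "composite_of standard_hom M' N\<^sub>2 (artin_map M' N\<^sub>2 h\<^sub>2)"
    by (rule compose\<^sub>2[OF step\<^sub>0(3) step\<^sub>1(3) step\<^sub>2(3)])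
  from composite_of_artin_map[of standard_hom, OF composite_of_artin_map[of standard_hom, OF this L(3) word\<^sub>2 L(2)] L(5)
      word_map_comp[OF word\<^sub>2 L(2)] L(4)]
  have std: "composite_of standard_hom M' N\<^sub>3
      (artin_map M' N\<^sub>3 (\<lambda>i. concat (map (\<lambda>x. [\<rho> x]) (concat (map h' (h\<^sub>2 i))))))"
    .
  show "composite_of standard_hom M' M (artin_map M' M (\<lambda>i. replicate (d i) (f i)))"
  proof (rule compose[OF std word_map_comp[OF word_map_comp[OF word\<^sub>2 L(2)] L(4)] _ step\<^sub>4(3) step\<^sub>5(3)])
    \<comment> \<open>The two factors through \<open>L\<close> compose to \<open>h\<^sub>3\<close>
      on letters of \<open>N\<^sub>3\<close>, and \<open>h\<^sub>2\<close> produces no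
      others.\<close>
    fix i assume "i \<in> index M'"
    then have "set (h\<^sub>2 i) \<subseteq> index N\<^sub>3"
      using word_mapD(1)[OF word\<^sub>2] index23 by (auto simp: in_lists_conv_set)
    moreover have "concat (map (\<lambda>x. [\<rho> x]) (concat (map h' u))) = concat (map h\<^sub>3 u)"
      if "set u \<subseteq> index N\<^sub>3" for u
      using that comp by (induction u) auto
    ultimately show "concat (map (\<lambda>x. [\<rho> x]) (concat (map h' (h\<^sub>2 i)))) = concat (map h\<^sub>3 (h\<^sub>2 i))"
      by blast
  qed
qed

theorem theorem4p34:
  fixes M' M :: "('a::infinite) coxeter_data"
    and \<Phi> :: "'a list set \<Rightarrow> 'a list set"
  assumes "light_hom M' M \<Phi>"
  shows "composite_of elementary_light_hom M' M \<Phi> \<and> composite_of standard_hom M' M \<Phi>"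
proof -
  have "coxeter_matrix M'" "coxeter_matrix M"
    using assms by (auto simp: light_hom_def artin_hom_def)
  then show ?thesis
    using light_hom_artin_map[OF assms] composite_of_replicate_artin_map by metis
qed

end
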